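(* Let $q>2$ be an integer and let $Q$ be an integer with $q\le Q\le Q(q)$, where $$Q(q)=\bigg[\frac{\big(2\sqrt{q-1}+1+\sqrt{4\sqrt{q-1}+1}\big)^2}{4}\bigg]+1$$ and $[t]$ denotes the integer part of $t$. If $\lambda>\|A_{\mathbb G^{Q,q}}\|$, then $$R_{A_{\mathbb G^{Q,q}}}(\lambda)=R_{A_{\mathbb G^Q}}(\lambda)\Big(\mathbf 1_{\ell^2(\mathbb G^Q)}+P_{\ell^2(\mathbb G^q)}\Big(\mathbf 1_{\ell^2(\mathbb G^q)}-\tfrac1\lambda W\big(\tfrac1\lambda\big)\Big)^{-1}P_{\ell^2(\mathbb G^q)}R_{A_{\mathbb G^Q}}(\lambda)\Big),$$ where $W(\xi)$ is the operator acting on $\ell^2(\mathbb G^q)$ whose matrix elements are, for $x,y\in\mathbb G^q\subset\mathbb G^Q$, $$W_{x,y}(\xi)=\bigg(\frac{1-\sqrt{1-4(Q-1)\xi^2}}{2(Q-1)\xi}\bigg)^{d(x,y)}\frac{2(Q-1)}{Q-2+Q\sqrt{1-4(Q-1)\xi^2}}.$$ In addition, $\mathbb G^{Q,q}$ is transient.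
   Context: For a graph $X$ (undirected, self-loops allowed) the adjacency operator $A_X$ acts on $\ell^2(VX)$ and its matrix entry $A_{xy}$ is the number of edges joining $x$ and $y$; a single self-loop at $x$ contributes $A_{xx}=1$. $\mathbb G^Q$ is the homogeneous Cayley tree of order $Q$ (the infinite tree in which every vertex has degree $Q$), with graph distance $d$. For $q\le Q$, $\mathbb G^{Q,q}$ is the graph obtained from $\mathbb G^Q$ by adding one self-loop at each vertex of a fixed subtree isomorphic to $\mathbb G^q$, denoted by $\mathbb G^q\subset\mathbb G^Q$; $P_{\ell^2(\mathbb G^q)}$ is the orthogonal projection of $\ell^2(\mathbb G^Q)$ onto $\ell^2(\mathbb G^q)$. $R_B(\lambda)=(\lambda\mathbf 1-B)^{-1}$ is the resolvent. A connected graph with bounded selfadjoint adjacency $A$ is called recurrent if $\lim_{\lambda\downarrow\|A\|}\langle R_A(\lambda)\delta_x,\delta_x\rangle=+\infty$ for a vertex $x$ (the property does not depend on $x$), and transient otherwise. *)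

theory Defs
  imports "HOL-Analysis.Analysis"
begin

section \<open>The Hilbert space of square-summable functions\<close>

typedef 'v ell2 = "{f :: 'v \<Rightarrow> complex. (\<lambda>x. (cmod (f x))\<^sup>2) summable_on UNIV}"
  morphisms coord Abs_ell2
  by (rule exI[of _ "\<lambda>_. 0"]) simp

setup_lifting type_definition_ell2

lemma coord_summable: "(\<lambda>x. (cmod (coord f x))\<^sup>2) summable_on UNIV"
  using coord[of f] by simp

lemma ell2_eqI: "(\<And>x. coord f x = coord g x) \<Longrightarrow> f = g"
  by (metis coord_inject ext)

lemma sq_summable_add:
  assumes "(\<lambda>x. (cmod (f x))\<^sup>2) summable_on UNIV" and "(\<lambda>x. (cmod (g x))\<^sup>2) summable_on UNIV"
  shows "(\<lambda>x. (cmod (f x + g x))\<^sup>2) summable_on UNIV"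
proof (rule summable_on_comparison_test)
  show "(\<lambda>x. 2 * (cmod (f x))\<^sup>2 + 2 * (cmod (g x))\<^sup>2) summable_on UNIV"
    using assms by (intro summable_on_add summable_on_cmult_right)
  fix x
  have "(cmod (f x + g x))\<^sup>2 \<le> (cmod (f x) + cmod (g x))\<^sup>2"
    by (intro power_mono norm_triangle_ineq) simp
  also have "\<dots> \<le> 2 * (cmod (f x))\<^sup>2 + 2 * (cmod (g x))\<^sup>2"
    using sum_squares_bound[of "cmod (f x)" "cmod (g x)"] by (simp add: power2_sum)
  finally show "(cmod (f x + g x))\<^sup>2 \<le> 2 * (cmod (f x))\<^sup>2 + 2 * (cmod (g x))\<^sup>2" .
qed simp

lemma sq_summable_inner:
  assumes "(\<lambda>x. (cmod (f x))\<^sup>2) summable_on UNIV" and "(\<lambda>x. (cmod (g x))\<^sup>2) summable_on UNIV"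
  shows "(\<lambda>x. inner (f x) (g x)) summable_on UNIV"
proof (rule abs_summable_summable, rule summable_on_comparison_test)
  show "(\<lambda>x. (cmod (f x))\<^sup>2 + (cmod (g x))\<^sup>2) summable_on UNIV"
    using assms by (intro summable_on_add)
  fix x
  have "\<bar>inner (f x) (g x)\<bar> \<le> cmod (f x) * cmod (g x)"
    by (rule Cauchy_Schwarz_ineq2)
  also have "\<dots> \<le> (cmod (f x))\<^sup>2 + (cmod (g x))\<^sup>2"
    using sum_squares_bound[of "cmod (f x)" "cmod (g x)"]
      mult_nonneg_nonneg[OF norm_ge_zero[of "f x"] norm_ge_zero[of "g x"]] by linarith
  finally show "norm (inner (f x) (g x)) \<le> (cmod (f x))\<^sup>2 + (cmod (g x))\<^sup>2" by simp
qed simp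

instantiation ell2 :: (type) real_vector
begin

lift_definition zero_ell2 :: "'a ell2" is "\<lambda>_. 0" by simp
lift_definition plus_ell2 :: "'a ell2 \<Rightarrow> 'a ell2 \<Rightarrow> 'a ell2" is "\<lambda>f g x. f x + g x"
  by (rule sq_summable_add)
lift_definition uminus_ell2 :: "'a ell2 \<Rightarrow> 'a ell2" is "\<lambda>f x. - f x" by simp
lift_definition minus_ell2 :: "'a ell2 \<Rightarrow> 'a ell2 \<Rightarrow> 'a ell2" is "\<lambda>f g x. f x - g x"
  using sq_summable_add[of _ "\<lambda>x. - g x" for g] by simp
lift_definition scaleR_ell2 :: "real \<Rightarrow> 'a ell2 \<Rightarrow> 'a ell2" is "\<lambda>r f x. r *\<^sub>R f x"
  by (simp add: power_mult_distrib summable_on_cmult_right)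

instance
proof
  fix f g h :: "'a ell2" and r s :: real
  show "f + g + h = f + (g + h)" "f + g = g + f" "0 + f = f" "- f + f = 0" "f - g = f + - g"
    by (transfer, simp add: algebra_simps)+
  show "r *\<^sub>R (f + g) = r *\<^sub>R f + r *\<^sub>R g" "(r + s) *\<^sub>R f = r *\<^sub>R f + s *\<^sub>R f"
    "r *\<^sub>R s *\<^sub>R f = (r * s) *\<^sub>R f" "1 *\<^sub>R f = f"
    by (transfer, simp add: algebra_simps)+
qed

end

text \<open>The real inner product is the real part of the Hermitian one (\<open>cinner\<close> below); both
  induce the same norm.\<close>

instantiation ell2 :: (type) real_inner
begin

definition inner_ell2 :: "'a ell2 \<Rightarrow> 'a ell2 \<Rightarrow> real"
  where "inner_ell2 f g = (\<Sum>\<^sub>\<infinity>x. inner (coord f x) (coord g x))"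
definition norm_ell2 :: "'a ell2 \<Rightarrow> real"
  where "norm_ell2 f = sqrt (\<Sum>\<^sub>\<infinity>x. (cmod (coord f x))\<^sup>2)"
definition sgn_ell2 :: "'a ell2 \<Rightarrow> 'a ell2" where "sgn_ell2 f = f /\<^sub>R norm f"
definition dist_ell2 :: "'a ell2 \<Rightarrow> 'a ell2 \<Rightarrow> real" where "dist_ell2 f g = norm (f - g)"
definition uniformity_ell2 :: "('a ell2 \<times> 'a ell2) filter"
  where "uniformity_ell2 = (INF e\<in>{0 <..}. principal {(f, g). dist f g < e})"
definition open_ell2 :: "'a ell2 set \<Rightarrow> bool"
  where "open_ell2 U = (\<forall>f\<in>U. eventually (\<lambda>(f', g). f' = f \<longrightarrow> g \<in> U) uniformity)"

instance
proof
  fix f g h :: "'a ell2" and r s :: real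
  show "sgn f = f /\<^sub>R norm f" "dist f g = norm (f - g)"
    by (simp_all add: sgn_ell2_def dist_ell2_def)
  show "(uniformity :: ('a ell2 \<times> 'a ell2) filter)
      = (INF e\<in>{0 <..}. principal {(f, g). dist f g < e})"
    by (rule uniformity_ell2_def)
  show "open U = (\<forall>f\<in>U. eventually (\<lambda>(f', g). f' = f \<longrightarrow> g \<in> U) uniformity)"
    for U :: "'a ell2 set" by (rule open_ell2_def)
  show "inner f g = inner g f" by (simp add: inner_ell2_def inner_commute)
  show "inner (f + g) h = inner f h + inner g h"
    by (simp add: inner_ell2_def plus_ell2.rep_eq inner_add_left infsum_add
        sq_summable_inner coord_summable)
  show "inner (r *\<^sub>R f) g = r * inner f g"
    by (simp add: inner_ell2_def scaleR_ell2.rep_eq infsum_cmult_right')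
  show "0 \<le> inner f f" by (simp add: inner_ell2_def infsum_nonneg)
  show "(inner f f = 0) = (f = 0)"
  proof
    assume "inner f f = 0"
    hence "inner (coord f x) (coord f x) = 0" for x
      using nonneg_infsum_le_0D[of "\<lambda>x. inner (coord f x) (coord f x)" UNIV x]
        sq_summable_inner[OF coord_summable coord_summable, of f f]
      by (simp add: inner_ell2_def)
    thus "f = 0" by (intro ell2_eqI) (simp add: zero_ell2.rep_eq)
  qed (simp add: inner_ell2_def zero_ell2.rep_eq)
  show "norm f = sqrt (inner f f)"
    by (simp add: norm_ell2_def inner_ell2_def power2_norm_eq_inner)
qed

end

definition cinner :: "'v ell2 \<Rightarrow> 'v ell2 \<Rightarrow> complex"
  where "cinner f g = (\<Sum>\<^sub>\<infinity>x. coord f x * cnj (coord g x))"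

lift_definition delta :: "'v \<Rightarrow> 'v ell2" is "\<lambda>a x. if x = a then 1 else 0"
proof -
  fix a :: 'v
  show "(\<lambda>x. (cmod (if x = a then 1 else 0))\<^sup>2) summable_on UNIV"
    by (rule summable_on_cong_neutral[where S = "{a}", THEN iffD1]) auto
qed

text \<open>For a set \<open>V\<close> of vertices, the Hilbert space of square-summable functions on \<open>V\<close> is the
  closed subspace of functions vanishing off \<open>V\<close>. An operator on it is represented by
  a function on \<open>'v ell2\<close>; only its values on \<open>ell2_on V\<close> matter.\<close>

definition ell2_on :: "'v set \<Rightarrow> 'v ell2 set"
  where "ell2_on V = {f. \<forall>x. x \<notin> V \<longrightarrow> coord f x = 0}"

definition orth_proj :: "'v ell2 set \<Rightarrow> 'v ell2 \<Rightarrow> 'v ell2"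
  where "orth_proj M f = (THE g. g \<in> M \<and> (\<forall>h\<in>M. cinner (f - g) h = 0))"

definition matrix_apply :: "'v set \<Rightarrow> ('v \<Rightarrow> 'v \<Rightarrow> complex) \<Rightarrow> 'v ell2 \<Rightarrow> 'v \<Rightarrow> complex"
  where "matrix_apply V K f x = (if x \<in> V then \<Sum>\<^sub>\<infinity>y\<in>V. K x y * coord f y else 0)"

text \<open>The operator on \<open>ell2_on V\<close> with matrix elements \<open>K x y\<close>, extended by \<open>0\<close> on the orthogonal
  complement of \<open>ell2_on V\<close> (so that \<open>onorm\<close> is its norm as an operator on \<open>ell2_on V\<close>). It is
  meaningful only if \<open>bounded_matrix V K\<close> holds.\<close>

definition matrix_op :: "'v set \<Rightarrow> ('v \<Rightarrow> 'v \<Rightarrow> complex) \<Rightarrow> 'v ell2 \<Rightarrow> 'v ell2"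
  where "matrix_op V K f = Abs_ell2 (matrix_apply V K f)"

definition bounded_matrix :: "'v set \<Rightarrow> ('v \<Rightarrow> 'v \<Rightarrow> complex) \<Rightarrow> bool"
  where "bounded_matrix V K \<longleftrightarrow>
    (\<forall>f. (\<forall>x\<in>V. (\<lambda>y. K x y * coord f y) summable_on V) \<and>
         (\<lambda>x. (cmod (matrix_apply V K f x))\<^sup>2) summable_on UNIV) \<and>
    bounded_linear (matrix_op V K)"

definition invertible_on :: "'v ell2 set \<Rightarrow> ('v ell2 \<Rightarrow> 'v ell2) \<Rightarrow> bool"
  where "invertible_on M B \<longleftrightarrow> bij_betw B M M \<and> (\<exists>C. \<forall>f\<in>M. norm f \<le> C * norm (B f))"

definition resolvent :: "'v ell2 set \<Rightarrow> ('v ell2 \<Rightarrow> 'v ell2) \<Rightarrow> real \<Rightarrow> 'v ell2 \<Rightarrow> 'v ell2"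
  where "resolvent M B l = inv_into M (\<lambda>f. l *\<^sub>R f - B f)"


section \<open>Graphs\<close>

text \<open>\<open>mult X x y\<close> is the number of edges joining \<open>x\<close> and \<open>y\<close>; \<open>mult X x x\<close> is the number of
  self-loops at \<open>x\<close>, each counted once.\<close>

record 'v graph =
  verts :: "'v set"
  mult :: "'v \<Rightarrow> 'v \<Rightarrow> nat"

definition wf_graph :: "'v graph \<Rightarrow> bool"
  where "wf_graph X \<longleftrightarrow> (\<forall>x y. mult X x y = mult X y x) \<and>
    (\<forall>x y. mult X x y > 0 \<longrightarrow> x \<in> verts X \<and> y \<in> verts X)"

definition walk :: "'v graph \<Rightarrow> 'v list \<Rightarrow> bool"
  where "walk X xs \<longleftrightarrow> xs \<noteq> [] \<and> set xs \<subseteq> verts X \<and> successively (\<lambda>x y. mult X x y > 0) xs"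

definition connected_graph :: "'v graph \<Rightarrow> bool"
  where "connected_graph X \<longleftrightarrow> wf_graph X \<and> verts X \<noteq> {} \<and>
    (\<forall>x\<in>verts X. \<forall>y\<in>verts X. \<exists>xs. walk X xs \<and> hd xs = x \<and> last xs = y)"

definition graph_dist :: "'v graph \<Rightarrow> 'v \<Rightarrow> 'v \<Rightarrow> nat"
  where "graph_dist X x y =
    (LEAST n. \<exists>xs. walk X xs \<and> hd xs = x \<and> last xs = y \<and> length xs = Suc n)"

definition tree :: "'v graph \<Rightarrow> bool"
  where "tree X \<longleftrightarrow> connected_graph X \<and> (\<forall>x. mult X x x = 0) \<and> (\<forall>x y. mult X x y \<le> 1) \<and>
    \<not> (\<exists>xs. walk X xs \<and> distinct xs \<and> 3 \<le> length xs \<and> mult X (last xs) (hd xs) > 0)"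

text \<open>The homogeneous tree of order \<open>n\<close> is determined by this property up to isomorphism.\<close>

definition homogeneous_tree :: "nat \<Rightarrow> 'v graph \<Rightarrow> bool"
  where "homogeneous_tree n X \<longleftrightarrow> tree X \<and> infinite (verts X) \<and>
    (\<forall>x\<in>verts X. card {y. mult X x y > 0} = n)"

definition subgraph :: "'v graph \<Rightarrow> 'v graph \<Rightarrow> bool"
  where "subgraph Y X \<longleftrightarrow> verts Y \<subseteq> verts X \<and> (\<forall>x y. mult Y x y \<le> mult X x y)"

definition add_loops :: "'v set \<Rightarrow> 'v graph \<Rightarrow> 'v graph"
  where "add_loops S X = X\<lparr>mult := (\<lambda>x y. mult X x y + (if x = y \<and> x \<in> S then 1 else 0))\<rparr>"

abbreviation l2 :: "'v graph \<Rightarrow> 'v ell2 set"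
  where "l2 X \<equiv> ell2_on (verts X)"

abbreviation adj_matrix :: "'v graph \<Rightarrow> 'v \<Rightarrow> 'v \<Rightarrow> complex"
  where "adj_matrix X x y \<equiv> of_nat (mult X x y)"

definition adj :: "'v graph \<Rightarrow> 'v ell2 \<Rightarrow> 'v ell2"
  where "adj X = matrix_op (verts X) (adj_matrix X)"

definition bounded_selfadjoint_adj :: "'v graph \<Rightarrow> bool"
  where "bounded_selfadjoint_adj X \<longleftrightarrow> bounded_matrix (verts X) (adj_matrix X) \<and>
    (\<forall>f\<in>l2 X. \<forall>g\<in>l2 X. cinner (adj X f) g = cinner f (adj X g))"

text \<open>The diagonal matrix element below is
  real for \<open>l > onorm (adj X)\<close>, since \<open>adj X\<close> is selfadjoint.\<close>

abbreviation adj_resolvent :: "'v graph \<Rightarrow> real \<Rightarrow> 'v ell2 \<Rightarrow> 'v ell2"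
  where "adj_resolvent X \<equiv> resolvent (l2 X) (adj X)"

definition recurrent :: "'v graph \<Rightarrow> bool"
  where "recurrent X \<longleftrightarrow> connected_graph X \<and> bounded_selfadjoint_adj X \<and>
    (\<exists>x\<in>verts X. filterlim (\<lambda>l. Re (cinner (adj_resolvent X l (delta x)) (delta x))) at_top
      (at_right (onorm (adj X))))"

definition transient :: "'v graph \<Rightarrow> bool"
  where "transient X \<longleftrightarrow> connected_graph X \<and> bounded_selfadjoint_adj X \<and> \<not> recurrent X"


section \<open>Perturbing a homogeneous tree along a homogeneous subtree\<close>

definition Q_max :: "nat \<Rightarrow> int"
  where "Q_max q =
    \<lfloor>(2 * sqrt (real q - 1) + 1 + sqrt (4 * sqrt (real q - 1) + 1))\<^sup>2 / 4\<rfloor> + 1"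

definition W_entry :: "nat \<Rightarrow> 'v graph \<Rightarrow> real \<Rightarrow> 'v \<Rightarrow> 'v \<Rightarrow> real"
  where "W_entry Q X \<xi> x y =
    ((1 - sqrt (1 - 4 * (real Q - 1) * \<xi>\<^sup>2)) / (2 * (real Q - 1) * \<xi>)) ^ graph_dist X x y *
    (2 * (real Q - 1) / (real Q - 2 + real Q * sqrt (1 - 4 * (real Q - 1) * \<xi>\<^sup>2)))"

abbreviation W_matrix :: "nat \<Rightarrow> 'v graph \<Rightarrow> real \<Rightarrow> 'v \<Rightarrow> 'v \<Rightarrow> complex"
  where "W_matrix Q X \<xi> x y \<equiv> complex_of_real (W_entry Q X \<xi> x y)"

definition W_op :: "nat \<Rightarrow> 'v graph \<Rightarrow> 'v graph \<Rightarrow> real \<Rightarrow> 'v ell2 \<Rightarrow> 'v ell2"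
  where "W_op Q X T \<xi> = matrix_op (verts T) (W_matrix Q X \<xi>)"

end

(* Let A be the adjacency operator of X, P the projection onto l2(T) and H = A + P the adjacency
   operator of the looped graph, with resolvents R and S. Since H dominates A entrywise,
   norm A <= norm H, and on the tree X the matrix of R is c * r^d. So (1/l) W(1/l) = P R P on l2(T), and
   both the invertibility of 1 - P R P and the resolvent formula follow from R (f + P S f) = S f.

   For transience, let a be a vertex of T. The kernel c * r^d restricted to T inverts
   (1/r + (q-1) r) 1 - A_T, with the same r. Hence phi = P S delta_a is a nonnegative solution of
   (m - A_T) phi = delta_a with m = 1/r + (q-1) r - 1. Its sums over the spheres of T, rescaled by
   sqrt (q-1)^k, satisfy a three-term recurrence whose positive solutions are concave for
   m < 2 sqrt (q-1), which is absurd. So m >= 2 sqrt (q-1), and then they are convex; being bounded they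
   decrease, which bounds phi(a) by sqrt (q-1) / (q-2) uniformly in l > norm H. *)

theory Submission
  imports Defs
begin

section \<open>Square-summable functions\<close>

text \<open>The norm of H is never computed, yet a bound is needed all the way down to it. What is
  available for every l above the norm is nonnegativity of the Green function. One fact then serves
  X and T alike: a nonnegative Green function with parameter m on a tree of degree n forces m \<ge>
  2 sqrt (n-1).

  Passing from degree Q to degree q works because \<open>r ^ d\<close> behaves alike on all
  homogeneous trees. Away from the pole one neighbour is nearer and n-1 are farther, giving the
  eigenvalue 1/r + (n-1) r; at the pole the defect is 1/r - r whatever n is. Distances in T and X
  agree, so c = r / (1 - r^2) normalizes both kernels and only the eigenvalue changes.

  The bound sqrt (q-1) / (q-2) is the diagonal Green function of T at 2 sqrt (q-1), the norm of its
  adjacency operator. It blows up as q approaches 2, where T would be the recurrent line.\<close>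

lemma norm_ell2_squared: "(norm f)\<^sup>2 = (\<Sum>\<^sub>\<infinity>x. (cmod (coord f x))\<^sup>2)"
  by (simp add: norm_ell2_def infsum_nonneg)

lemma sum_coord_le_norm: "finite F \<Longrightarrow> (\<Sum>x\<in>F. (cmod (coord f x))\<^sup>2) \<le> (norm f)\<^sup>2"
  unfolding norm_ell2_squared by (rule finite_sum_le_infsum[OF coord_summable]) auto

lemma cmod_coord_le_norm: "cmod (coord f x) \<le> norm f"
  using sum_coord_le_norm[of "{x}" f] by (auto dest: power2_le_imp_le)

text \<open>\<open>Abs_ell2\<close> says nothing about a function that is not square-summable.
  Uniform bounds on finite sums settle membership, coordinates and norm at once.\<close>

lemma bounded_finite_sums_ell2:
  assumes "0 \<le> C" and bd: "\<And>F. finite F \<Longrightarrow> (\<Sum>x\<in>F. (cmod (f x))\<^sup>2) \<le> C\<^sup>2"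
  shows "(\<lambda>x. (cmod (f x))\<^sup>2) summable_on UNIV" "coord (Abs_ell2 f) = f" "norm (Abs_ell2 f) \<le> C"
proof -
  show s: "(\<lambda>x. (cmod (f x))\<^sup>2) summable_on UNIV"
    by (rule nonneg_bdd_above_summable_on) (auto intro!: bdd_aboveI2[of _ _ "C\<^sup>2"] bd)
  show c: "coord (Abs_ell2 f) = f"
    using s by (simp add: Abs_ell2_inverse)
  have "(norm (Abs_ell2 f))\<^sup>2 \<le> C\<^sup>2"
    unfolding norm_ell2_squared c by (rule infsum_le_finite_sums[OF s]) (use bd in auto)
  thus "norm (Abs_ell2 f) \<le> C" using \<open>0 \<le> C\<close> by (rule power2_le_imp_le)
qed

lemma bounded_linear_coord: "bounded_linear (\<lambda>f. coord f x)"
  by (rule bounded_linear_intro[where K = 1])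
    (auto simp: plus_ell2.rep_eq scaleR_ell2.rep_eq cmod_coord_le_norm)

lemmas coord_simps = plus_ell2.rep_eq minus_ell2.rep_eq uminus_ell2.rep_eq scaleR_ell2.rep_eq
  zero_ell2.rep_eq delta.rep_eq

lemma complete_UNIV_ell2: "complete (UNIV :: 'v ell2 set)"
  unfolding complete_def
proof (intro allI impI, elim conjE)
  fix X :: "nat \<Rightarrow> 'v ell2"
  assume "Cauchy X"
  have "Cauchy (\<lambda>n. coord (X n) x)" for x
    using \<open>Cauchy X\<close> by (rule bounded_linear.Cauchy[OF bounded_linear_coord])
  hence "\<exists>g. \<forall>x. (\<lambda>n. coord (X n) x) \<longlonglongrightarrow> g x"
    by (meson Cauchy_convergent convergent_def)
  then obtain g where g: "(\<lambda>n. coord (X n) x) \<longlonglongrightarrow> g x" for x by blast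
  \<comment> \<open>Fatou's argument: over a finite set the Cauchy estimate survives the limit in
    \<open>m\<close>, with a bound that does not depend on the set.\<close>
  have bd: "(\<Sum>x\<in>F. (cmod (coord (X n) x - g x))\<^sup>2) \<le> e\<^sup>2"
    if "finite F" "n \<ge> N" "\<forall>m\<ge>N. \<forall>n\<ge>N. dist (X m) (X n) < e" for F n N e
  proof (rule LIMSEQ_le_const2)
    show "(\<lambda>m. \<Sum>x\<in>F. (cmod (coord (X n) x - coord (X m) x))\<^sup>2)
      \<longlonglongrightarrow> (\<Sum>x\<in>F. (cmod (coord (X n) x - g x))\<^sup>2)"
      by (intro tendsto_intros g)
    have "(\<Sum>x\<in>F. (cmod (coord (X n) x - coord (X m) x))\<^sup>2) \<le> e\<^sup>2" if "m \<ge> N" for m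
    proof -
      have "(\<Sum>x\<in>F. (cmod (coord (X n) x - coord (X m) x))\<^sup>2) \<le> (norm (X n - X m))\<^sup>2"
        using sum_coord_le_norm[OF \<open>finite F\<close>, of "X n - X m"] by (simp add: coord_simps)
      also have "\<dots> \<le> e\<^sup>2"
        using \<open>\<forall>m\<ge>N. \<forall>n\<ge>N. dist (X m) (X n) < e\<close> \<open>n \<ge> N\<close> that
        by (intro power_mono) (auto simp: dist_norm less_imp_le)
      finally show ?thesis .
    qed
    thus "\<exists>N. \<forall>m\<ge>N. (\<Sum>x\<in>F. (cmod (coord (X n) x - coord (X m) x))\<^sup>2) \<le> e\<^sup>2" by blast
  qed
  obtain N1 where N1: "\<forall>m\<ge>N1. \<forall>n\<ge>N1. dist (X m) (X n) < 1"
    using \<open>Cauchy X\<close> unfolding Cauchy_def by (meson zero_less_one)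
  \<comment> \<open>The coordinatewise limit \<open>g\<close> is not yet known to be
    square-summable, but \<open>X N1 - g\<close> is, by \<open>bd\<close> with bound 1; so the limit
    is obtained by subtracting from \<open>X N1\<close>.\<close>
  define G where "G = X N1 - Abs_ell2 (\<lambda>x. coord (X N1) x - g x)"
  have G: "coord G x = g x" for x
    unfolding G_def coord_simps
    by (subst bounded_finite_sums_ell2(2)[where C = 1]) (use bd[OF _ order.refl N1] in auto)
  have "X \<longlonglongrightarrow> G"
  proof (rule metric_LIMSEQ_I)
    fix e :: real assume "0 < e"
    then obtain N where N: "\<forall>m\<ge>N. \<forall>n\<ge>N. dist (X m) (X n) < e / 2"
      using \<open>Cauchy X\<close> unfolding Cauchy_def by (meson half_gt_zero)
    have "dist (X n) G < e" if "n \<ge> N" for n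
    proof -
      have eq: "X n - G = Abs_ell2 (\<lambda>x. coord (X n) x - g x)"
        by (rule ell2_eqI, subst bounded_finite_sums_ell2(2)[where C = "e / 2"])
          (use bd[OF _ that N] \<open>0 < e\<close> in \<open>auto simp: coord_simps G\<close>)
      have "norm (X n - G) \<le> e / 2"
        unfolding eq by (rule bounded_finite_sums_ell2(3)) (use bd[OF _ that N] \<open>0 < e\<close> in auto)
      thus ?thesis using \<open>0 < e\<close> by (simp add: dist_norm)
    qed
    thus "\<exists>N. \<forall>n\<ge>N. dist (X n) G < e" by blast
  qed
  thus "\<exists>l\<in>UNIV. X \<longlonglongrightarrow> l" by blast
qed

text \<open>Membership includes being real, so positivity of a Green function also yields its
  invariance under \<open>cnj\<close>.\<close>

definition ell2_nonneg :: "'v ell2 set"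
  where "ell2_nonneg = {f. \<forall>x. coord f x \<in> \<real>\<^sub>\<ge>\<^sub>0}"

text \<open>Coordinates are continuous, so this is an intersection of closed sets. It covers both
  the coordinate subspaces and their positive cones, the two kinds of sets on which the fixed-point
  argument for resolvents runs.\<close>

lemma complete_coordwise_closed:
  fixes S :: "'v \<Rightarrow> complex set"
  assumes "\<And>x. closed (S x)"
  shows "complete {f. \<forall>x. coord f x \<in> S x}"
proof (rule complete_closed_subset[OF _ subset_UNIV complete_UNIV_ell2])
  have "{f. \<forall>x. coord f x \<in> S x} = (\<Inter>x. (\<lambda>f. coord f x) -` S x)" by auto
  also have "closed \<dots>"
    by (intro closed_INT ballI closed_vimage assms linear_continuous_on bounded_linear_coord)
  finally show "closed {f. \<forall>x. coord f x \<in> S x}" .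
qed

lemma complete_ell2_on: "complete (ell2_on V)"
proof -
  have "ell2_on V = {f. \<forall>x. coord f x \<in> (if x \<in> V then UNIV else {0})}"
    by (auto simp: ell2_on_def split: if_splits)
  thus ?thesis by (simp add: complete_coordwise_closed)
qed

lemma complete_ell2_on_nonneg: "complete (ell2_on V \<inter> ell2_nonneg)"
proof -
  have "ell2_on V \<inter> ell2_nonneg = {f. \<forall>x. coord f x \<in> (if x \<in> V then \<real>\<^sub>\<ge>\<^sub>0 else {0})}"
    by (auto simp: ell2_on_def ell2_nonneg_def split: if_splits) (metis nonneg_Reals_zero_I)
  thus ?thesis by (simp add: complete_coordwise_closed)
qed

lemma delta_in_ell2_on [simp]: "delta x \<in> ell2_on V \<longleftrightarrow> x \<in> V"
  by (auto simp: ell2_on_def coord_simps)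

lemma delta_in_ell2_nonneg [simp]: "delta x \<in> ell2_nonneg"
  by (auto simp: ell2_nonneg_def coord_simps)

section \<open>The Hermitian inner product\<close>

lemma cinner_delta_right: "cinner f (delta x) = coord f x"
proof -
  have "cinner f (delta x) = infsum (\<lambda>y. coord f y * cnj (coord (delta x) y)) {x}"
    unfolding cinner_def by (rule infsum_cong_neutral) (auto simp: coord_simps)
  thus ?thesis by (simp add: coord_simps)
qed

lemma ell2_mult_abs_summable: "(\<lambda>x. cmod (coord f x * coord g x)) summable_on UNIV"
proof (rule summable_on_comparison_test)
  show "(\<lambda>x. (cmod (coord f x))\<^sup>2 + (cmod (coord g x))\<^sup>2) summable_on UNIV"
    by (intro summable_on_add coord_summable)
  fix x
  show "cmod (coord f x * coord g x) \<le> (cmod (coord f x))\<^sup>2 + (cmod (coord g x))\<^sup>2"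
    using sum_squares_bound[of "cmod (coord f x)" "cmod (coord g x)"]
      mult_nonneg_nonneg[OF norm_ge_zero[of "coord f x"] norm_ge_zero[of "coord g x"]]
    unfolding norm_mult by linarith
qed simp

lemma cinner_summable: "(\<lambda>x. coord f x * cnj (coord g x)) summable_on UNIV"
  by (rule abs_summable_summable[OF summable_on_comparison_test[OF ell2_mult_abs_summable[of f g]]])
     (simp_all add: norm_mult)

lemma cinner_diff_left: "cinner (f - g) h = cinner f h - cinner g h"
  using infsum_add[OF cinner_summable[of f h] cinner_summable[of "- g" h]]
  by (simp add: cinner_def coord_simps left_diff_distrib infsum_uminus)

lemma cinner_diff_right: "cinner h (f - g) = cinner h f - cinner h g"
  using infsum_add[OF cinner_summable[of h f] cinner_summable[of h "- g"]]
  by (simp add: cinner_def coord_simps right_diff_distrib infsum_uminus)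

lemma cinner_scaleR_left: "cinner (r *\<^sub>R f) g = of_real r * cinner f g"
  by (simp add: cinner_def coord_simps scaleR_conv_of_real mult.assoc infsum_cmult_right')

lemma cinner_scaleR_right: "cinner f (r *\<^sub>R g) = of_real r * cinner f g"
  by (simp add: cinner_def coord_simps scaleR_conv_of_real mult.left_commute infsum_cmult_right')

lemma cinner_add_right: "cinner h (f + g) = cinner h f + cinner h g"
proof -
  have "cinner h (0 - g) = cinner h 0 - cinner h g" by (rule cinner_diff_right)
  moreover have "cinner h 0 = 0" by (simp add: cinner_def coord_simps)
  ultimately have "cinner h (- g) = - cinner h g" by simp
  thus ?thesis using cinner_diff_right[of h f "- g"] by simp
qed

lemma cinner_sum_right: "finite F \<Longrightarrow> cinner h (\<Sum>y\<in>F. f y) = (\<Sum>y\<in>F. cinner h (f y))"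
  by (induction F rule: finite_induct) (simp_all add: cinner_add_right, simp add: cinner_def coord_simps)

lemma coord_sum: "finite F \<Longrightarrow> coord (\<Sum>y\<in>F. f y) x = (\<Sum>y\<in>F. coord (f y) x)"
  by (induction F rule: finite_induct) (simp_all add: coord_simps)

section \<open>Orthogonal projection onto a coordinate subspace\<close>

lift_definition restrict_ell2 :: "'v set \<Rightarrow> 'v ell2 \<Rightarrow> 'v ell2"
  is "\<lambda>V f x. if x \<in> V then f x else 0"
  by (rule summable_on_comparison_test) auto

lemma restrict_ell2_in: "restrict_ell2 V f \<in> ell2_on V"
  by (simp add: ell2_on_def restrict_ell2.rep_eq)

lemma restrict_ell2_idem: "f \<in> ell2_on V \<Longrightarrow> restrict_ell2 V f = f"
  by (rule ell2_eqI) (simp add: restrict_ell2.rep_eq ell2_on_def)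

lemma norm_restrict_ell2_le: "norm (restrict_ell2 V f) \<le> norm f"
  unfolding norm_ell2_def
  by (intro real_sqrt_le_mono infsum_mono coord_summable) (auto simp: restrict_ell2.rep_eq)

lemma bounded_linear_restrict_ell2: "bounded_linear (restrict_ell2 V)"
  by (rule bounded_linear_intro[where K = 1])
    (auto intro!: ell2_eqI simp: coord_simps restrict_ell2.rep_eq norm_restrict_ell2_le)

text \<open>Orthogonality holds because the supports are disjoint; uniqueness, needed for
  \<open>THE\<close>, follows by testing against \<open>delta x\<close> with x in V.\<close>

lemma orth_proj_ell2_on: "orth_proj (ell2_on V) f = restrict_ell2 V f"
  unfolding orth_proj_def
proof (rule the_equality, intro conjI ballI)
  fix h assume "h \<in> ell2_on V"
  thus "cinner (f - restrict_ell2 V f) h = 0"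
    by (auto simp: cinner_def coord_simps restrict_ell2.rep_eq ell2_on_def intro!: infsum_0)
next
  fix g assume g: "g \<in> ell2_on V \<and> (\<forall>h\<in>ell2_on V. cinner (f - g) h = 0)"
  show "g = restrict_ell2 V f"
  proof (rule ell2_eqI)
    fix x
    have "cinner (f - g) (delta x) = 0" if "x \<in> V" using g that by simp
    thus "coord g x = coord (restrict_ell2 V f) x"
      using g by (auto simp: restrict_ell2.rep_eq ell2_on_def coord_simps cinner_delta_right)
  qed
qed (rule restrict_ell2_in)

section \<open>Resolvents\<close>

lemma resolvent_lower_bound:
  assumes "bounded_linear B"
  shows "(l - onorm B) * norm f \<le> norm (l *\<^sub>R f - B f)"
proof -
  have "l * norm f \<le> norm (l *\<^sub>R f)"
    by (simp add: mult_right_mono)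
  also have "\<dots> \<le> norm (l *\<^sub>R f - B f) + norm (B f)"
    by (metis diff_add_cancel norm_triangle_ineq)
  also have "norm (B f) \<le> onorm B * norm f"
    using assms by (rule onorm)
  finally show ?thesis by (simp add: algebra_simps)
qed

text \<open>The solution is the fixed point of the map taking g to
  \<open>(1 / l) *\<^sub>R (B g + f)\<close>, a contraction with factor \<open>onorm B / l\<close>.
  Leaving the invariant set \<open>S\<close> free gives existence when \<open>S\<close> is a
  subspace and positivity when it is a cone.\<close>

lemma resolvent_equation_solvable:
  fixes B :: "'v ell2 \<Rightarrow> 'v ell2"
  assumes B: "bounded_linear B" and l: "onorm B < l" and S: "complete S" "S \<noteq> {}"
    and inv: "\<And>g. g \<in> S \<Longrightarrow> (1 / l) *\<^sub>R (B g + f) \<in> S"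
  shows "\<exists>g\<in>S. l *\<^sub>R g - B g = f"
proof -
  have pos: "0 \<le> onorm B" using B by (rule onorm_pos_le)
  interpret bounded_linear B by fact
  have "\<exists>!g. g \<in> S \<and> (1 / l) *\<^sub>R (B g + f) = g"
  proof (rule Banach_fix[OF S, of "onorm B / l"])
    fix g h
    have "dist ((1 / l) *\<^sub>R (B g + f)) ((1 / l) *\<^sub>R (B h + f)) = norm (B (g - h)) / l"
      using pos l by (simp add: dist_norm diff flip: scaleR_diff_right)
    also have "\<dots> \<le> onorm B * norm (g - h) / l"
      using pos l by (intro divide_right_mono onorm B) auto
    finally show "dist ((1 / l) *\<^sub>R (B g + f)) ((1 / l) *\<^sub>R (B h + f)) \<le> onorm B / l * dist g h"
      by (simp add: dist_norm)
  qed (use pos l inv in auto)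
  then obtain g where "g \<in> S" and g: "(1 / l) *\<^sub>R (B g + f) = g" by blast
  have "l *\<^sub>R g = l *\<^sub>R ((1 / l) *\<^sub>R (B g + f))" using g by simp
  also have "\<dots> = B g + f" using pos l by simp
  finally show ?thesis using \<open>g \<in> S\<close> by (intro bexI[of _ g]) simp_all
qed

lemma ell2_on_closed:
  shows "f \<in> ell2_on V \<Longrightarrow> r *\<^sub>R f \<in> ell2_on V"
    and "f \<in> ell2_on V \<Longrightarrow> g \<in> ell2_on V \<Longrightarrow> f + g \<in> ell2_on V"
    and "f \<in> ell2_on V \<Longrightarrow> g \<in> ell2_on V \<Longrightarrow> f - g \<in> ell2_on V"
  by (auto simp: ell2_on_def coord_simps)

locale ell2_operator =
  fixes V :: "'v set" and B :: "'v ell2 \<Rightarrow> 'v ell2"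
  assumes bounded_linear: "bounded_linear B" and range: "B f \<in> ell2_on V"
begin

context
  fixes l assumes l: "onorm B < l"
begin

lemma shift_inj: "l *\<^sub>R f - B f = l *\<^sub>R g - B g \<Longrightarrow> f = g"
proof -
  interpret bounded_linear B by (rule bounded_linear)
  assume "l *\<^sub>R f - B f = l *\<^sub>R g - B g"
  hence "l *\<^sub>R (f - g) - B (f - g) = 0"
    by (simp add: algebra_simps diff)
  with resolvent_lower_bound[OF bounded_linear, of l "f - g"] l show "f = g"
    by (simp add: mult_le_0_iff)
qed

lemma shift_bij: "bij_betw (\<lambda>f. l *\<^sub>R f - B f) (ell2_on V) (ell2_on V)"
proof (rule bij_betwI')
  fix f g
  show "(l *\<^sub>R f - B f = l *\<^sub>R g - B g) = (f = g)" using shift_inj by blast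
next
  fix f assume "f \<in> ell2_on V"
  thus "l *\<^sub>R f - B f \<in> ell2_on V" by (intro ell2_on_closed range)
next
  fix f assume f: "f \<in> ell2_on V"
  have "\<exists>g\<in>ell2_on V. l *\<^sub>R g - B g = f"
  proof (rule resolvent_equation_solvable[OF bounded_linear l complete_ell2_on])
    show "ell2_on V \<noteq> {}" using f by blast
    show "(1 / l) *\<^sub>R (B g + f) \<in> ell2_on V" for g
      using f by (intro ell2_on_closed range)
  qed
  thus "\<exists>g\<in>ell2_on V. f = l *\<^sub>R g - B g" by blast
qed

lemma shift_bounded_below: "norm f \<le> 1 / (l - onorm B) * norm (l *\<^sub>R f - B f)"
  using resolvent_lower_bound[OF bounded_linear, of l f] l by (simp add: field_simps)

lemma shift_invertible: "invertible_on (ell2_on V) (\<lambda>f. l *\<^sub>R f - B f)"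
  unfolding invertible_on_def using shift_bij shift_bounded_below by blast

lemma resolvent_in: "f \<in> ell2_on V \<Longrightarrow> resolvent (ell2_on V) B l f \<in> ell2_on V"
  unfolding resolvent_def using shift_bij by (metis bij_betw_def inv_into_into)

lemma resolvent_solves:
  "f \<in> ell2_on V \<Longrightarrow>
    l *\<^sub>R resolvent (ell2_on V) B l f - B (resolvent (ell2_on V) B l f) = f"
  unfolding resolvent_def using bij_betw_inv_into_right[OF shift_bij] by blast

lemma resolvent_eqI:
  "g \<in> ell2_on V \<Longrightarrow> l *\<^sub>R g - B g = f \<Longrightarrow> resolvent (ell2_on V) B l f = g"
  unfolding resolvent_def using bij_betw_inv_into_left[OF shift_bij] by blast

lemma norm_resolvent_le:
  "f \<in> ell2_on V \<Longrightarrow> norm (resolvent (ell2_on V) B l f) \<le> 1 / (l - onorm B) * norm f"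
  using shift_bounded_below[of "resolvent (ell2_on V) B l f"] by (simp add: resolvent_solves)

lemma resolvent_add:
  assumes "f \<in> ell2_on V" "g \<in> ell2_on V"
  shows "resolvent (ell2_on V) B l (f + g) =
    resolvent (ell2_on V) B l f + resolvent (ell2_on V) B l g"
proof (rule resolvent_eqI)
  interpret bounded_linear B by (rule bounded_linear)
  show "l *\<^sub>R (resolvent (ell2_on V) B l f + resolvent (ell2_on V) B l g) -
    B (resolvent (ell2_on V) B l f + resolvent (ell2_on V) B l g) = f + g"
    using resolvent_solves[OF assms(1)] resolvent_solves[OF assms(2)]
    by (simp add: add algebra_simps)
qed (intro ell2_on_closed resolvent_in assms)

lemma resolvent_scaleR:
  assumes "f \<in> ell2_on V"
  shows "resolvent (ell2_on V) B l (r *\<^sub>R f) = r *\<^sub>R resolvent (ell2_on V) B l f"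
proof (rule resolvent_eqI)
  interpret bounded_linear B by (rule bounded_linear)
  have "l *\<^sub>R (r *\<^sub>R resolvent (ell2_on V) B l f) - B (r *\<^sub>R resolvent (ell2_on V) B l f)
    = r *\<^sub>R (l *\<^sub>R resolvent (ell2_on V) B l f - B (resolvent (ell2_on V) B l f))"
    by (simp add: scaleR scaleR_diff_right mult.commute)
  thus "l *\<^sub>R (r *\<^sub>R resolvent (ell2_on V) B l f) - B (r *\<^sub>R resolvent (ell2_on V) B l f) = r *\<^sub>R f"
    using resolvent_solves[OF assms] by simp
qed (intro ell2_on_closed resolvent_in assms)

text \<open>The fixed point is constructed again inside the positive cone, which is stable because
  \<open>l > 0\<close>; uniqueness identifies it with the resolvent.\<close>

lemma resolvent_nonneg:
  assumes B: "\<And>g. g \<in> ell2_nonneg \<Longrightarrow> B g \<in> ell2_nonneg"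
    and f: "f \<in> ell2_on V" "f \<in> ell2_nonneg"
  shows "resolvent (ell2_on V) B l f \<in> ell2_nonneg"
proof -
  have "0 < l" using l onorm_pos_le[OF bounded_linear] by linarith
  have "\<exists>g\<in>ell2_on V \<inter> ell2_nonneg. l *\<^sub>R g - B g = f"
  proof (rule resolvent_equation_solvable[OF bounded_linear l complete_ell2_on_nonneg])
    show "ell2_on V \<inter> ell2_nonneg \<noteq> {}" using f by blast
    fix g assume g: "g \<in> ell2_on V \<inter> ell2_nonneg"
    have "(1 / l) *\<^sub>R (B g + f) \<in> ell2_nonneg"
      using B[of g] g f(2) \<open>0 < l\<close>
      by (auto simp: ell2_nonneg_def coord_simps scaleR_conv_of_real
          intro!: nonneg_Reals_mult_I nonneg_Reals_add_I)
    thus "(1 / l) *\<^sub>R (B g + f) \<in> ell2_on V \<inter> ell2_nonneg"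
      using f(1) by (intro IntI ell2_on_closed range)
  qed
  then obtain g where "g \<in> ell2_on V" "g \<in> ell2_nonneg" "l *\<^sub>R g - B g = f" by blast
  thus ?thesis using resolvent_eqI[of g f] by simp
qed

lemma resolvent_selfadjoint:
  assumes "\<And>f g. cinner (B f) g = cinner f (B g)" and fg: "f \<in> ell2_on V" "g \<in> ell2_on V"
  shows "cinner (resolvent (ell2_on V) B l f) g = cinner f (resolvent (ell2_on V) B l g)"
proof -
  let ?R = "resolvent (ell2_on V) B l"
  have "cinner (?R f) g = cinner (?R f) (l *\<^sub>R ?R g - B (?R g))"
    using resolvent_solves[OF fg(2)] by simp
  also have "\<dots> = cinner (l *\<^sub>R ?R f - B (?R f)) (?R g)"
    by (simp add: cinner_diff_left cinner_diff_right cinner_scaleR_left cinner_scaleR_right assms(1))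
  also have "\<dots> = cinner f (?R g)"
    using resolvent_solves[OF fg(1)] by simp
  finally show ?thesis .
qed

end

end

lemma norm_ell2_mono:
  assumes "\<And>x. cmod (coord f x) \<le> cmod (coord g x)"
  shows "norm f \<le> norm g"
  unfolding norm_ell2_def
  by (intro real_sqrt_le_mono infsum_mono coord_summable power_mono assms) simp_all

text \<open>Taking moduli preserves the norm and turns triangle inequalities into identities for
  operators with nonnegative entries; this is how adjacency norms are compared.\<close>

lift_definition abs_ell2 :: "'v ell2 \<Rightarrow> 'v ell2" is "\<lambda>f x. complex_of_real (cmod (f x))"
  by simp

lemma norm_abs_ell2: "norm (abs_ell2 f) = norm f"
  by (simp add: norm_ell2_def abs_ell2.rep_eq)

section \<open>Graphs of bounded degree\<close>

definition nbrs :: "'v graph \<Rightarrow> 'v \<Rightarrow> 'v set"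
  where "nbrs G x = {y. mult G x y > 0}"

text \<open>A loop at x just puts x into \<open>nbrs G x\<close>, so the tree and the looped tree
  are both instances.\<close>

locale bounded_degree_graph =
  fixes G :: "'v graph" and D :: nat
  assumes wf: "wf_graph G"
    and mult_le_1: "mult G x y \<le> 1"
    and finite_nbrs: "finite (nbrs G x)"
    and card_nbrs: "card (nbrs G x) \<le> D"
begin

lemma nbrs_sym: "x \<in> nbrs G y \<longleftrightarrow> y \<in> nbrs G x"
  using wf by (simp add: nbrs_def wf_graph_def)

lemma nbrs_verts: "y \<in> nbrs G x \<Longrightarrow> x \<in> verts G \<and> y \<in> verts G"
  using wf by (auto simp: nbrs_def wf_graph_def)

lemma mult_eq: "mult G x y = (if y \<in> nbrs G x then 1 else 0)"
  using mult_le_1[of x y] by (auto simp: nbrs_def)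

lemma adj_row_summable: "(\<lambda>y. adj_matrix G x y * h y) summable_on S"
  by (rule summable_on_cong_neutral[where S = "nbrs G x \<inter> S" and g = "\<lambda>y. adj_matrix G x y * h y",
        THEN iffD1]) (use finite_nbrs in \<open>auto simp: mult_eq\<close>)

lemma matrix_apply_adj: "matrix_apply (verts G) (adj_matrix G) f x = (\<Sum>y\<in>nbrs G x. coord f y)"
proof (cases "x \<in> verts G")
  case True
  have "(\<Sum>\<^sub>\<infinity>y\<in>verts G. adj_matrix G x y * coord f y) = (\<Sum>\<^sub>\<infinity>y\<in>nbrs G x. coord f y)"
    by (rule infsum_cong_neutral) (auto simp: mult_eq dest: nbrs_verts)
  thus ?thesis using True finite_nbrs by (simp add: matrix_apply_def)
next
  case False
  hence "nbrs G x = {}" using nbrs_verts by blast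
  thus ?thesis using False by (simp add: matrix_apply_def)
qed

text \<open>Schur's test: Cauchy-Schwarz over at most D neighbours costs one factor D, and double
  counting, each y being a neighbour of at most D vertices x, costs the other.\<close>

lemma sum_nbrs_bound:
  assumes "finite F"
  shows "(\<Sum>x\<in>F. (cmod (\<Sum>y\<in>nbrs G x. coord f y))\<^sup>2) \<le> (real D * norm f)\<^sup>2"
proof -
  let ?U = "\<Union>x\<in>F. nbrs G x"
  have fin: "finite ?U" using assms finite_nbrs by blast
  have "(cmod (\<Sum>y\<in>nbrs G x. coord f y))\<^sup>2 \<le> real D * (\<Sum>y\<in>nbrs G x. (cmod (coord f y))\<^sup>2)" for x
  proof -
    have "(cmod (\<Sum>y\<in>nbrs G x. coord f y))\<^sup>2 \<le> (\<Sum>y\<in>nbrs G x. cmod (coord f y))\<^sup>2"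
      by (intro power_mono norm_sum) simp
    also have "\<dots> \<le> (\<Sum>y\<in>nbrs G x. (cmod (coord f y))\<^sup>2) * card (nbrs G x)"
      by (rule sum_squared_le_sum_of_squares)
    also have "\<dots> \<le> (\<Sum>y\<in>nbrs G x. (cmod (coord f y))\<^sup>2) * D"
      by (intro mult_left_mono sum_nonneg) (use card_nbrs in auto)
    finally show ?thesis by (simp add: mult.commute)
  qed
  hence "(\<Sum>x\<in>F. (cmod (\<Sum>y\<in>nbrs G x. coord f y))\<^sup>2)
      \<le> real D * (\<Sum>x\<in>F. \<Sum>y\<in>nbrs G x. (cmod (coord f y))\<^sup>2)"
    unfolding sum_distrib_left by (rule sum_mono)
  also have "(\<Sum>x\<in>F. \<Sum>y\<in>nbrs G x. (cmod (coord f y))\<^sup>2)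
      = (\<Sum>x\<in>F. \<Sum>y | y \<in> ?U \<and> y \<in> nbrs G x. (cmod (coord f y))\<^sup>2)"
    by (intro sum.cong refl) auto
  also have "\<dots> = (\<Sum>y\<in>?U. \<Sum>x | x \<in> F \<and> y \<in> nbrs G x. (cmod (coord f y))\<^sup>2)"
    by (rule sum.swap_restrict[OF assms fin])
  also have "\<dots> = (\<Sum>y\<in>?U. card {x \<in> F. y \<in> nbrs G x} * (cmod (coord f y))\<^sup>2)"
    by simp
  also have "\<dots> \<le> (\<Sum>y\<in>?U. D * (cmod (coord f y))\<^sup>2)"
  proof (intro sum_mono mult_right_mono)
    fix y
    have "card {x \<in> F. y \<in> nbrs G x} \<le> card (nbrs G y)"
      by (rule card_mono[OF finite_nbrs]) (auto simp: nbrs_sym)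
    thus "real (card {x \<in> F. y \<in> nbrs G x}) \<le> D" using card_nbrs[of y] by simp
  qed simp
  also have "\<dots> \<le> D * (norm f)\<^sup>2"
    unfolding sum_distrib_left[symmetric] by (intro mult_left_mono sum_coord_le_norm fin) simp
  finally show ?thesis
    by (simp add: power_mult_distrib power2_eq_square[of "real D"] mult_left_mono mult.assoc)
qed

lemma coord_adj: "coord (adj G f) x = (\<Sum>y\<in>nbrs G x. coord f y)"
  and norm_adj_le: "norm (adj G f) \<le> real D * norm f"
  and adj_square_summable: "(\<lambda>x. (cmod (matrix_apply (verts G) (adj_matrix G) f x))\<^sup>2) summable_on UNIV"
proof -
  have eq: "matrix_apply (verts G) (adj_matrix G) f = (\<lambda>x. \<Sum>y\<in>nbrs G x. coord f y)"
    by (rule ext) (rule matrix_apply_adj)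
  note * = bounded_finite_sums_ell2[of "real D * norm f" "\<lambda>x. \<Sum>y\<in>nbrs G x. coord f y",
      OF _ sum_nbrs_bound]
  show "coord (adj G f) x = (\<Sum>y\<in>nbrs G x. coord f y)"
    by (simp add: adj_def matrix_op_def eq *)
  show "norm (adj G f) \<le> real D * norm f"
    by (simp add: adj_def matrix_op_def eq *)
  show "(\<lambda>x. (cmod (matrix_apply (verts G) (adj_matrix G) f x))\<^sup>2) summable_on UNIV"
    by (simp add: eq *)
qed

lemma bounded_linear_adj: "bounded_linear (adj G)"
  by (rule bounded_linear_intro[where K = "real D"])
    (auto intro!: ell2_eqI simp: coord_adj coord_simps sum.distrib scaleR_sum_right norm_adj_le
      mult.commute)

lemma bounded_matrix_adj: "bounded_matrix (verts G) (adj_matrix G)"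
  unfolding bounded_matrix_def using bounded_linear_adj
  by (simp add: adj_def adj_row_summable adj_square_summable)

lemma adj_in: "adj G f \<in> l2 G"
  by (auto simp: ell2_on_def coord_adj dest!: nbrs_verts intro!: sum.neutral)

sublocale adj: ell2_operator "verts G" "adj G"
  by (rule ell2_operator.intro) (fact bounded_linear_adj adj_in)+

lemma adj_nonneg: "f \<in> ell2_nonneg \<Longrightarrow> adj G f \<in> ell2_nonneg"
  by (auto simp: ell2_nonneg_def coord_adj complex_nonneg_Reals_iff sum_nonneg)

lemma cmod_adj_abs: "cmod (coord (adj G (abs_ell2 f)) x) = (\<Sum>y\<in>nbrs G x. cmod (coord f y))"
proof -
  have "coord (adj G (abs_ell2 f)) x = of_real (\<Sum>y\<in>nbrs G x. cmod (coord f y))"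
    by (simp add: coord_adj abs_ell2.rep_eq)
  thus ?thesis by (simp only: norm_of_real abs_of_nonneg sum_nonneg norm_ge_zero)
qed

text \<open>An exchange of summations. It is legitimate because the row sums of the moduli are the
  moduli of the products of coordinates of \<open>adj G (abs_ell2 f)\<close> and \<open>g\<close>,
  hence summable.\<close>

lemma adj_selfadjoint: "cinner (adj G f) g = cinner f (adj G g)"
proof -
  define p where "p x y = adj_matrix G x y * coord f y * cnj (coord g x)" for x y
  have row: "((\<lambda>y. cmod (p x y)) has_sum cmod (coord (adj G (abs_ell2 f)) x * coord g x)) UNIV" for x
  proof -
    have "((\<lambda>y. cmod (p x y)) has_sum (\<Sum>y\<in>nbrs G x. cmod (p x y))) UNIV"
      by (rule has_sum_cong_neutral[THEN iffD1, OF _ _ _ has_sum_finite[OF finite_nbrs]])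
        (auto simp: p_def mult_eq)
    moreover have "cmod (coord (adj G (abs_ell2 f)) x * coord g x) = (\<Sum>y\<in>nbrs G x. cmod (p x y))"
      by (simp add: cmod_adj_abs norm_mult p_def mult_eq sum_distrib_right)
    ultimately show ?thesis by simp
  qed
  have "(\<lambda>z. cmod (case_prod p z)) summable_on (UNIV \<times> UNIV)"
    by (rule summable_on_SigmaI[OF _ ell2_mult_abs_summable]) (use row in auto)
  hence "case_prod p summable_on UNIV \<times> UNIV"
    by (rule abs_summable_summable)
  hence "(\<Sum>\<^sub>\<infinity>x. \<Sum>\<^sub>\<infinity>y. p x y) = (\<Sum>\<^sub>\<infinity>y. \<Sum>\<^sub>\<infinity>x. p x y)"
    by (rule infsum_swap_banach)
  moreover have "(\<Sum>\<^sub>\<infinity>y. p x y) = coord (adj G f) x * cnj (coord g x)" for x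
  proof -
    have "(\<Sum>\<^sub>\<infinity>y. p x y) = (\<Sum>\<^sub>\<infinity>y\<in>nbrs G x. coord f y * cnj (coord g x))"
      by (rule infsum_cong_neutral) (auto simp: p_def mult_eq)
    thus ?thesis by (simp add: finite_nbrs coord_adj sum_distrib_right)
  qed
  moreover have "(\<Sum>\<^sub>\<infinity>x. p x y) = coord f y * cnj (coord (adj G g) y)" for y
  proof -
    have "(\<Sum>\<^sub>\<infinity>x. p x y) = (\<Sum>\<^sub>\<infinity>x\<in>nbrs G y. coord f y * cnj (coord g x))"
      by (rule infsum_cong_neutral) (auto simp: p_def mult_eq nbrs_sym)
    thus ?thesis by (simp add: finite_nbrs coord_adj sum_distrib_left)
  qed
  ultimately show ?thesis by (simp add: cinner_def)
qed

lemma bounded_selfadjoint: "bounded_selfadjoint_adj G"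
  by (simp add: bounded_selfadjoint_adj_def bounded_matrix_adj adj_selfadjoint)

end

text \<open>With nonnegative entries, the modulus of \<open>adj G f\<close> is dominated
  coordinatewise by \<open>adj G' (abs_ell2 f)\<close>, and \<open>abs_ell2 f\<close> has the norm
  of \<open>f\<close>.\<close>

lemma onorm_adj_mono:
  assumes "bounded_degree_graph G D" "bounded_degree_graph G' D'"
    and sub: "\<And>x. nbrs G x \<subseteq> nbrs G' x"
  shows "onorm (adj G) \<le> onorm (adj G')"
proof -
  interpret G: bounded_degree_graph G D by fact
  interpret G': bounded_degree_graph G' D' by fact
  show ?thesis
  proof (rule onorm_bound[OF onorm_pos_le[OF G'.bounded_linear_adj]])
    fix f
    have "cmod (coord (adj G f) x) \<le> cmod (coord (adj G' (abs_ell2 f)) x)" for x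
    proof -
      have "cmod (coord (adj G f) x) \<le> (\<Sum>y\<in>nbrs G x. cmod (coord f y))"
        by (simp add: G.coord_adj norm_sum)
      also have "\<dots> \<le> (\<Sum>y\<in>nbrs G' x. cmod (coord f y))"
        by (rule sum_mono2[OF G'.finite_nbrs sub]) simp
      finally show ?thesis by (simp add: G'.cmod_adj_abs)
    qed
    hence "norm (adj G f) \<le> norm (adj G' (abs_ell2 f))"
      by (rule norm_ell2_mono)
    also have "\<dots> \<le> onorm (adj G') * norm (abs_ell2 f)"
      by (rule onorm[OF G'.bounded_linear_adj])
    finally show "norm (adj G f) \<le> onorm (adj G') * norm f"
      by (simp add: norm_abs_ell2)
  qed
qed

section \<open>Distance in trees\<close>

context
  fixes X :: "'v graph"
  assumes conn: "connected_graph X"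
begin

lemma edge_sym: "mult X x y > 0 \<longleftrightarrow> mult X y x > 0"
  using conn by (simp add: connected_graph_def wf_graph_def)

lemma edge_verts: "mult X x y > 0 \<Longrightarrow> x \<in> verts X \<and> y \<in> verts X"
  using conn by (auto simp: connected_graph_def wf_graph_def)

lemma walk_rev: "walk X xs \<Longrightarrow> walk X (rev xs)"
  by (auto simp: walk_def successively_rev edge_sym elim: successively_mono)

lemma graph_dist_walk:
  assumes "x \<in> verts X" "y \<in> verts X"
  obtains xs where "walk X xs" "hd xs = x" "last xs = y" "length xs = Suc (graph_dist X x y)"
proof -
  obtain xs where "walk X xs" "hd xs = x" "last xs = y"
    using conn assms unfolding connected_graph_def by blast
  moreover from this have "length xs = Suc (length xs - 1)" by (simp add: walk_def)
  ultimately have "\<exists>n xs. walk X xs \<and> hd xs = x \<and> last xs = y \<and> length xs = Suc n" by blast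
  from LeastI_ex[OF this] show thesis using that unfolding graph_dist_def by blast
qed

lemma graph_dist_le:
  "walk X xs \<Longrightarrow> length xs = Suc n \<Longrightarrow> graph_dist X (hd xs) (last xs) \<le> n"
  unfolding graph_dist_def by (rule Least_le) blast

lemma graph_dist_sym:
  assumes "x \<in> verts X" "y \<in> verts X"
  shows "graph_dist X x y = graph_dist X y x"
proof -
  have "graph_dist X x y \<le> graph_dist X y x" if xy: "x \<in> verts X" "y \<in> verts X" for x y
  proof -
    obtain xs where "walk X xs" "hd xs = y" "last xs = x" "length xs = Suc (graph_dist X y x)"
      using graph_dist_walk[OF xy(2,1)] by blast
    thus ?thesis using graph_dist_le[OF walk_rev, of xs] by (simp add: hd_rev last_rev)
  qed
  thus ?thesis using assms by (simp add: order.antisym)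
qed

lemma graph_dist_self: "x \<in> verts X \<Longrightarrow> graph_dist X x x = 0"
  using graph_dist_le[of "[x]" 0] by (simp add: walk_def)

lemma graph_dist_eq_0:
  assumes "x \<in> verts X" "y \<in> verts X" "graph_dist X x y = 0"
  shows "x = y"
proof -
  obtain xs where "hd xs = x" "last xs = y" "length xs = Suc 0"
    using graph_dist_walk[OF assms(1,2)] assms(3) by metis
  thus ?thesis by (cases xs) auto
qed

lemma graph_dist_edge_le:
  assumes "a \<in> verts X" and e: "mult X x y > 0"
  shows "graph_dist X a y \<le> Suc (graph_dist X a x)"
proof -
  have xy: "x \<in> verts X" "y \<in> verts X" using edge_verts[OF e] by auto
  obtain xs where xs: "walk X xs" "hd xs = a" "last xs = x" "length xs = Suc (graph_dist X a x)"
    using graph_dist_walk[OF assms(1) xy(1)] by blast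
  have "walk X (xs @ [y])"
    using xs xy(2) e by (auto simp: walk_def successively_append_iff)
  from graph_dist_le[OF this] xs show ?thesis by (simp add: walk_def)
qed

text \<open>The witness is the last vertex but one of a shortest walk; the edge bound keeps it from
  being closer to \<open>a\<close> than \<open>n\<close>.\<close>

lemma graph_dist_pred:
  assumes "a \<in> verts X" "y \<in> verts X" "graph_dist X a y = Suc n"
  obtains x where "mult X y x > 0" "graph_dist X a x = n"
proof -
  obtain xs where xs: "walk X xs" "hd xs = a" "last xs = y" "length xs = Suc (Suc n)"
    using graph_dist_walk[OF assms(1,2)] assms(3) by metis
  define ys where "ys = butlast xs"
  have ne: "ys \<noteq> []" using xs(4) by (auto simp: ys_def simp flip: length_0_conv)
  have eq: "xs = ys @ [y]" using xs by (metis ys_def append_butlast_last_id walk_def)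
  have ys: "walk X ys" and e: "mult X (last ys) y > 0"
    using xs(1) ne by (auto simp: eq walk_def successively_append_iff)
  have "graph_dist X (hd ys) (last ys) \<le> n"
    by (rule graph_dist_le[OF ys]) (use xs(4) in \<open>simp add: eq\<close>)
  moreover have "hd ys = a" using xs(2) ne by (simp add: eq)
  moreover have "Suc n \<le> Suc (graph_dist X a (last ys))"
    using graph_dist_edge_le[OF assms(1) e] assms(3) by simp
  ultimately show thesis using that[of "last ys"] e by (simp add: edge_sym)
qed

end

text \<open>Two vertices at the same distance from \<open>a\<close> are joined by descending to a common ancestor.
  An edge inside a sphere, or a second neighbour closer to \<open>a\<close>, would close such a path to a cycle.\<close>

lemma path_below_sphere:
  assumes conn: "connected_graph X" and a: "a \<in> verts X"
    and "x \<in> verts X" "y \<in> verts X" "x \<noteq> y" "graph_dist X a x = n" "graph_dist X a y = n"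
  shows "\<exists>xs. walk X xs \<and> distinct xs \<and> 3 \<le> length xs \<and> hd xs = x \<and> last xs = y \<and>
    (\<forall>z\<in>set xs. graph_dist X a z \<le> n)"
  using assms(3-)
proof (induction n arbitrary: x y)
  case 0
  thus ?case using graph_dist_eq_0[OF conn a] by metis
next
  case (Suc n)
  obtain x' where x': "mult X x x' > 0" "graph_dist X a x' = n"
    using graph_dist_pred[OF conn a Suc.prems(1,4)] .
  obtain y' where y': "mult X y y' > 0" "graph_dist X a y' = n"
    using graph_dist_pred[OF conn a Suc.prems(2,5)] .
  have V: "x' \<in> verts X" "y' \<in> verts X"
    using edge_verts[OF conn] x'(1) y'(1) by auto
  have y'y: "mult X y' y > 0" using y'(1) edge_sym[OF conn] by blast
  show ?case
  proof (cases "x' = y'")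
    case True
    have "walk X [x, x', y]"
      using Suc.prems V x' y'y True by (auto simp: walk_def)
    moreover have "distinct [x, x', y]" using Suc.prems x' by auto
    ultimately show ?thesis using Suc.prems x' by (intro exI[of _ "[x, x', y]"]) simp
  next
    case False
    obtain xs where xs: "walk X xs" "distinct xs" "3 \<le> length xs" "hd xs = x'" "last xs = y'"
      "\<forall>z\<in>set xs. graph_dist X a z \<le> n"
      using Suc.IH[OF V False x'(2) y'(2)] by blast
    have notin: "x \<notin> set xs" "y \<notin> set xs" using xs(6) Suc.prems by auto
    have ne: "xs \<noteq> []" using xs(1) by (simp add: walk_def)
    have "walk X (x # xs @ [y])"
      using xs ne Suc.prems x'(1) y'y
      by (auto simp: walk_def successively_Cons successively_append_iff)
    moreover have "\<forall>z\<in>set (x # xs @ [y]). graph_dist X a z \<le> Suc n"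
      using xs(6) Suc.prems by auto
    ultimately show ?thesis using xs(2,3) notin Suc.prems
      by (intro exI[of _ "x # xs @ [y]"]) auto
  qed
qed

lemma tree_parent_unique:
  assumes "tree X" and a: "a \<in> verts X" and "mult X x y > 0" "mult X x z > 0"
    and "graph_dist X a x = Suc n" "graph_dist X a y = n" "graph_dist X a z = n"
  shows "y = z"
proof (rule ccontr)
  assume "y \<noteq> z"
  have conn: "connected_graph X" using \<open>tree X\<close> by (simp add: tree_def)
  have V: "x \<in> verts X" "y \<in> verts X" "z \<in> verts X" using edge_verts[OF conn] assms(3,4) by auto
  obtain xs where xs: "walk X xs" "distinct xs" "3 \<le> length xs" "hd xs = y" "last xs = z"
      "\<forall>v\<in>set xs. graph_dist X a v \<le> n"
    using path_below_sphere[OF conn a V(2,3) \<open>y \<noteq> z\<close> assms(6,7)] by blast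
  have "walk X (x # xs)" using xs V(1) assms(3) by (auto simp: walk_def successively_Cons)
  moreover have "distinct (x # xs)" using xs(2,6) assms(5) by auto
  moreover have "mult X (last (x # xs)) (hd (x # xs)) > 0"
    using xs assms(4) edge_sym[OF conn] by (auto simp: walk_def)
  moreover have "3 \<le> length (x # xs)" using xs(3) by simp
  ultimately show False using \<open>tree X\<close> unfolding tree_def by blast
qed

lemma tree_edge_dist:
  assumes "tree X" and a: "a \<in> verts X" and e: "mult X x y > 0"
  shows "graph_dist X a y = Suc (graph_dist X a x) \<or> graph_dist X a x = Suc (graph_dist X a y)"
proof -
  have conn: "connected_graph X" using \<open>tree X\<close> by (simp add: tree_def)
  have V: "x \<in> verts X" "y \<in> verts X" using edge_verts[OF conn e] by auto
  have e': "mult X y x > 0" using e edge_sym[OF conn] by blast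
  have "x \<noteq> y" using e \<open>tree X\<close> by (auto simp: tree_def)
  have "graph_dist X a x \<noteq> graph_dist X a y"
  proof
    assume eq: "graph_dist X a x = graph_dist X a y"
    obtain xs where "walk X xs" "distinct xs" "3 \<le> length xs" "hd xs = x" "last xs = y"
      using path_below_sphere[OF conn a V \<open>x \<noteq> y\<close> refl eq[symmetric]] by blast
    thus False using e' \<open>tree X\<close> unfolding tree_def by blast
  qed
  thus ?thesis
    using graph_dist_edge_le[OF conn a e] graph_dist_edge_le[OF conn a e'] by linarith
qed

text \<open>In a tree, the distance from \<open>a\<close> propagates along any walk without backtracking;
  so it can be read off any subtree.\<close>

lemma subtree_graph_dist:
  assumes X: "tree X" and T: "tree T" and sub: "subgraph T X" and a: "a \<in> verts T"
    and x: "x \<in> verts T"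
  shows "graph_dist X a x = graph_dist T a x"
  using x
proof (induction "graph_dist T a x" arbitrary: x rule: less_induct)
  case less
  have cX: "connected_graph X" and cT: "connected_graph T" using X T by (auto simp: tree_def)
  have oX: "a \<in> verts X" using a sub by (auto simp: subgraph_def)
  have edge: "mult X x y > 0" if "mult T x y > 0" for x y
    using sub that by (metis subgraph_def less_le_trans)
  show ?case
  proof (cases "graph_dist T a x")
    case 0
    hence "x = a" using graph_dist_eq_0[OF cT a less.prems] by simp
    thus ?thesis using 0 graph_dist_self[OF cX oX] by simp
  next
    case (Suc n)
    obtain p where p: "mult T x p > 0" "graph_dist T a p = n"
      using graph_dist_pred[OF cT a less.prems Suc] .
    have pT: "p \<in> verts T" using edge_verts[OF cT p(1)] by simp
    have dp: "graph_dist X a p = n" using less.hyps[OF _ pT] p(2) Suc by simp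
    have "graph_dist X a x = Suc n \<or> n = Suc (graph_dist X a x)"
      using tree_edge_dist[OF X oX edge[OF p(1)]] dp by auto
    \<comment> \<open>Otherwise \<open>g\<close> and \<open>x\<close> would both be parents of
      \<open>p\<close> in \<open>X\<close> and hence equal, although their distances from
      \<open>a\<close> in \<open>T\<close> are \<open>m\<close> and \<open>m + 2\<close>.\<close>
    moreover have False if n: "n = Suc (graph_dist X a x)"
    proof -
      obtain m where m: "n = Suc m" using n by blast
      have "graph_dist T a p = Suc m" using p(2) m by simp
      then obtain g where g: "mult T p g > 0" "graph_dist T a g = m"
        using graph_dist_pred[OF cT a pT] by blast
      have "g \<in> verts T" using edge_verts[OF cT g(1)] by simp
      hence "graph_dist X a g = m" using less.hyps g(2) Suc m by simp
      moreover have "graph_dist X a x = m" using n m by simp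
      moreover have "mult X p x > 0" using edge[OF p(1)] edge_sym[OF cX] by blast
      ultimately have "g = x"
        using tree_parent_unique[OF X oX edge[OF g(1)], of x m] dp m by simp
      thus False using g(2) Suc m by simp
    qed
    ultimately show ?thesis using Suc by auto
  qed
qed

section \<open>Spheres in a homogeneous tree\<close>

lemma iterated_difference_le:
  fixes b :: "nat \<Rightarrow> real"
  assumes "\<And>k. j \<le> k \<Longrightarrow> b (Suc k) - b k \<le> d"
  shows "b (j + m) \<le> b j + real m * d"
proof (induction m)
  case (Suc m)
  have "b (j + Suc m) - b (j + m) \<le> d" using assms[of "j + m"] by simp
  thus ?case using Suc by (simp add: algebra_simps)
qed simp

text \<open>If c < 2, the second differences \<open>- (2 - c) * b (Suc k)\<close> make
  \<open>b\<close> concave. A nonnegative concave sequence never decreases, so it stays above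
  \<open>b 0\<close>; then every step lowers the increment by at least \<open>(2 - c) * b 0\<close>,
  and it turns negative after all.\<close>

lemma concave_nonneg_recurrence:
  fixes b :: "nat \<Rightarrow> real"
  assumes nonneg: "\<And>k. 0 \<le> b k" and pos: "0 < b 0"
    and rec: "\<And>k. c * b (Suc k) = b k + b (Suc (Suc k))"
  shows "2 \<le> c"
proof (rule ccontr)
  assume "\<not> 2 \<le> c"
  hence c: "c < 2" by simp
  define d where "d k = b (Suc k) - b k" for k
  have step: "d (Suc k) - d k = - ((2 - c) * b (Suc k))" for k
    using rec[of k] by (simp add: d_def algebra_simps)
  have "d (Suc k) \<le> d k" for k
    using step[of k] c nonneg[of "Suc k"] mult_nonneg_nonneg[of "2 - c" "b (Suc k)"] by linarith
  hence anti: "d k \<le> d j" if "j \<le> k" for j k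
    using lift_Suc_antimono_le that by blast
  have d_nonneg: "0 \<le> d j" for j
  proof (rule ccontr)
    assume "\<not> 0 \<le> d j"
    then obtain m :: nat where m: "b j < real m * (- d j)"
      using reals_Archimedean3[of "- d j"] by auto
    have "b (j + m) \<le> b j + real m * d j"
      by (rule iterated_difference_le) (use anti in \<open>auto simp: d_def\<close>)
    thus False using m nonneg[of "j + m"] by simp
  qed
  have incr: "b 0 \<le> b k" for k
    by (rule lift_Suc_mono_le[of b]) (use d_nonneg in \<open>auto simp: d_def\<close>)
  have "d (Suc k) - d k \<le> - ((2 - c) * b 0)" for k
    using mult_left_mono[OF incr[of "Suc k"], of "2 - c"] c step[of k] by simp
  hence bound: "d (0 + m) \<le> d 0 + real m * - ((2 - c) * b 0)" for m
    by (rule iterated_difference_le)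
  obtain m :: nat where "d 0 < real m * ((2 - c) * b 0)"
    using reals_Archimedean3[of "(2 - c) * b 0"] c pos by auto
  thus False using bound[of m] d_nonneg[of m] by simp
qed

text \<open>For c \<ge> 2 the sequence is convex, so a positive first increment would force at least
  linear growth.\<close>

lemma convex_bounded_recurrence:
  fixes b :: "nat \<Rightarrow> real"
  assumes nonneg: "\<And>k. 0 \<le> b k" and bounded: "\<And>k. b k \<le> C"
    and c: "2 \<le> c" and rec: "\<And>k. c * b (Suc k) = b k + b (Suc (Suc k))"
  shows "b 1 \<le> b 0"
proof (rule ccontr)
  assume neg: "\<not> b 1 \<le> b 0"
  define d where "d k = b (Suc k) - b k" for k
  have "d (Suc k) - d k = (c - 2) * b (Suc k)" for k
    using rec[of k] by (simp add: d_def algebra_simps)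
  moreover have "0 \<le> (c - 2) * b (Suc k)" for k using c nonneg by simp
  ultimately have "d k \<le> d (Suc k)" for k by (metis diff_ge_0_iff_ge)
  hence incr: "d 0 \<le> d k" for k using lift_Suc_mono_le[of d 0 k] by blast
  have "- b (Suc k) - - b k \<le> - d 0" for k using incr[of k] by (simp add: d_def)
  hence upper: "- b (0 + m) \<le> - b 0 + real m * - d 0" for m by (rule iterated_difference_le)
  have lower: "b 0 + real m * d 0 \<le> b m" for m using upper[of m] by simp
  have "0 < d 0" using neg by (simp add: d_def)
  then obtain m :: nat where "C < real m * d 0" using reals_Archimedean3 by blast
  thus False using lower[of m] bounded[of m] nonneg[of 0] by simp
qed

locale homogeneous =
  fixes n :: nat and Y :: "'v graph"
  assumes hom: "homogeneous_tree n Y" and n_ge_3: "3 \<le> n"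
begin

lemma tree: "tree Y" and connected: "connected_graph Y"
  using hom by (auto simp: homogeneous_tree_def tree_def)

lemma degree: "x \<in> verts Y \<Longrightarrow> card (nbrs Y x) = n"
  using hom by (simp add: homogeneous_tree_def nbrs_def)

text \<open>Infinite sets have \<open>card\<close> 0, so a positive degree already gives
  finiteness.\<close>

lemma finite_nbrs: "finite (nbrs Y x)"
proof (cases "x \<in> verts Y")
  case True
  thus ?thesis using degree[OF True] n_ge_3 by (intro card_ge_0_finite) simp
next
  case False
  hence "nbrs Y x = {}" using edge_verts[OF connected] by (auto simp: nbrs_def)
  thus ?thesis by simp
qed

lemma bounded_degree: "bounded_degree_graph Y n"
proof
  show "wf_graph Y" using connected by (simp add: connected_graph_def)
  show "mult Y x y \<le> 1" for x y using tree by (simp add: tree_def)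
  show "finite (nbrs Y x)" for x by (rule finite_nbrs)
  show "card (nbrs Y x) \<le> n" for x
  proof (cases "x \<in> verts Y")
    case False
    hence "nbrs Y x = {}" using edge_verts[OF connected] by (auto simp: nbrs_def)
    thus ?thesis by simp
  qed (simp add: degree)
qed

sublocale bounded_degree_graph Y n by (rule bounded_degree)

section \<open>Levels and children seen from a fixed vertex\<close>

context
  fixes a assumes a: "a \<in> verts Y"
begin

abbreviation (input) level where "level x \<equiv> graph_dist Y a x"

definition level_set where "level_set k = {x \<in> verts Y. graph_dist Y a x = k}"

definition children where "children x = {y \<in> nbrs Y x. graph_dist Y a y = Suc (graph_dist Y a x)}"

lemma finite_children: "finite (children x)"
  by (simp add: children_def nbrs_sym finite_nbrs)

lemma level_set_0: "level_set 0 = {a}"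
  using a graph_dist_self[OF connected a] graph_dist_eq_0[OF connected a]
  by (auto simp: level_set_def)

lemma nbrs_centre: "nbrs Y a = children a"
  using graph_dist_self[OF connected a] tree_edge_dist[OF tree a, of a]
  by (auto simp: children_def nbrs_def)

lemma nbrs_parent:
  assumes x: "x \<in> level_set (Suc k)"
  obtains p where "p \<in> level_set k" "x \<in> children p" "p \<notin> children x" "nbrs Y x = insert p (children x)"
proof -
  have x': "x \<in> verts Y" "level x = Suc k" using x by (auto simp: level_set_def)
  obtain p where p: "mult Y x p > 0" "level p = k"
    using graph_dist_pred[OF connected a x'] .
  have "nbrs Y x = insert p (children x)"
  proof -
    have "y = p \<or> y \<in> children x" if y: "y \<in> nbrs Y x" for y
    proof (cases "level y = Suc (level x)")
      case False
      have e: "mult Y x y > 0" using y by (simp add: nbrs_def)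
      hence "level y = k" using tree_edge_dist[OF tree a e] False x'(2) by simp
      thus ?thesis using tree_parent_unique[OF tree a p(1) e x'(2) p(2)] by simp
    qed (use y in \<open>simp add: children_def\<close>)
    thus ?thesis using p(1) by (auto simp: children_def nbrs_def)
  qed
  moreover have "p \<in> level_set k" "x \<in> children p" "p \<notin> children x"
    using p x' edge_verts[OF connected p(1)] edge_sym[OF connected]
    by (auto simp: level_set_def children_def nbrs_def)
  ultimately show thesis using that by blast
qed

lemma children_disjoint:
  assumes "x \<in> children p" "x \<in> children p'" "p \<in> level_set k" "p' \<in> level_set k"
  shows "p = p'"
proof -
  have "mult Y x p > 0" "mult Y x p' > 0" "level x = Suc k" "level p = k" "level p' = k"
    using assms edge_sym[OF connected] by (auto simp: children_def nbrs_def level_set_def)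
  thus ?thesis using tree_parent_unique[OF tree a] by blast
qed

lemma level_set_Suc: "level_set (Suc k) = (\<Union>x\<in>level_set k. children x)"
proof
  show "level_set (Suc k) \<subseteq> (\<Union>x\<in>level_set k. children x)"
    using nbrs_parent by (metis UN_I subsetI)
  show "(\<Union>x\<in>level_set k. children x) \<subseteq> level_set (Suc k)"
    using edge_verts[OF connected] by (auto simp: children_def nbrs_def level_set_def)
qed

lemma finite_level_set: "finite (level_set k)"
  by (induction k) (auto simp: level_set_0 level_set_Suc finite_children)

lemma sum_level_set_Suc:
  "(\<Sum>x\<in>level_set (Suc k). f x) = (\<Sum>z\<in>level_set k. \<Sum>x\<in>children z. f x)"
  unfolding level_set_Suc
  by (rule sum.UNION_disjoint)
    (use children_disjoint in \<open>auto simp: finite_level_set finite_children\<close>)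

lemma card_children_centre: "card (children a) = n"
  using degree[OF a] by (simp add: nbrs_centre)

lemma card_children: "x \<in> level_set (Suc k) \<Longrightarrow> card (children x) = n - 1"
proof -
  assume x: "x \<in> level_set (Suc k)"
  obtain p where "p \<notin> children x" "nbrs Y x = insert p (children x)" using nbrs_parent[OF x] .
  moreover have "card (nbrs Y x) = n" using x by (simp add: level_set_def degree)
  ultimately show ?thesis by (simp add: finite_children)
qed

lemma card_level_set: "card (level_set (Suc k)) = n * (n - 1) ^ k"
proof (induction k)
  case 0
  show ?case by (simp add: level_set_Suc level_set_0 card_children_centre)
next
  case (Suc k)
  have "card (level_set (Suc (Suc k))) = (\<Sum>z\<in>level_set (Suc k). \<Sum>x\<in>children z. 1)"
    unfolding sum_level_set_Suc[symmetric] by simp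
  also have "\<dots> = (\<Sum>z\<in>level_set (Suc k). n - 1)"
    by (intro sum.cong refl) (simp add: card_children)
  also have "\<dots> = n * (n - 1) ^ Suc k" using Suc by simp
  finally show ?case .
qed

text \<open>A vertex z of level k is met once from each of its children, a vertex of level k + 2
  once from its unique parent. The factor stays \<open>card (children z)\<close> because the centre
  has n children and every other vertex n - 1.\<close>

lemma sum_level_set_nbrs:
  fixes f :: "'v \<Rightarrow> real"
  shows "(\<Sum>x\<in>level_set (Suc k). \<Sum>y\<in>nbrs Y x. f y)
    = (\<Sum>z\<in>level_set k. card (children z) * f z) + (\<Sum>x\<in>level_set (Suc (Suc k)). f x)"
proof -
  have "(\<Sum>x\<in>level_set (Suc k). \<Sum>y\<in>nbrs Y x. f y)
      = (\<Sum>z\<in>level_set k. \<Sum>x\<in>children z. \<Sum>y\<in>nbrs Y x. f y)"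
    by (rule sum_level_set_Suc)
  also have "\<dots> = (\<Sum>z\<in>level_set k. \<Sum>x\<in>children z. f z + (\<Sum>y\<in>children x. f y))"
  proof (intro sum.cong refl)
    fix z x assume z: "z \<in> level_set k" and x: "x \<in> children z"
    have "x \<in> level_set (Suc k)" using z x by (auto simp: level_set_Suc)
    then obtain p where p: "p \<in> level_set k" "x \<in> children p" "p \<notin> children x"
      "nbrs Y x = insert p (children x)" by (rule nbrs_parent)
    moreover have "p = z" using children_disjoint[OF p(2) x p(1) z] .
    ultimately show "(\<Sum>y\<in>nbrs Y x. f y) = f z + (\<Sum>y\<in>children x. f y)"
      by (simp add: finite_children)
  qed
  also have "\<dots> = (\<Sum>z\<in>level_set k. card (children z) * f z)
      + (\<Sum>z\<in>level_set k. \<Sum>x\<in>children z. \<Sum>y\<in>children x. f y)"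
    by (simp add: sum.distrib)
  finally show ?thesis by (simp only: sum_level_set_Suc)
qed

section \<open>Green functions on a homogeneous tree\<close>

text \<open>Summing the resolvent equation over spheres and rescaling by the growth rate
  \<open>sqrt (n - 1)\<close> gives a three-term recurrence with constant coefficients, concave or convex
  according to the position of \<open>m\<close> relative to \<open>2 * sqrt (n - 1)\<close>.\<close>

context
  fixes f :: "'v \<Rightarrow> real" and m :: real
  assumes f_nonneg: "\<And>x. x \<in> verts Y \<Longrightarrow> 0 \<le> f x"
    and eqn: "\<And>x. x \<in> verts Y \<Longrightarrow> m * f x = (\<Sum>y\<in>nbrs Y x. f y) + (if x = a then 1 else 0)"
begin

definition sphere_sum where "sphere_sum k = (\<Sum>x\<in>level_set k. f x)"

text \<open>The sequence starts at the sphere of radius 1: the centre has one child more than the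
  other vertices, so the coefficients are constant only from there on.\<close>

definition scaled_sum where "scaled_sum k = sphere_sum (Suc k) / sqrt (real n - 1) ^ k"

lemma sphere_sum_nonneg: "0 \<le> sphere_sum k"
  unfolding sphere_sum_def by (intro sum_nonneg f_nonneg) (simp add: level_set_def)

lemma sphere_eqn_0: "m * f a = sphere_sum 1 + 1"
  using eqn[OF a] by (simp add: nbrs_centre sphere_sum_def level_set_Suc level_set_0)

lemma sphere_eqn_Suc:
  "m * sphere_sum (Suc k) = (\<Sum>z\<in>level_set k. card (children z) * f z) + sphere_sum (Suc (Suc k))"
proof -
  have "m * sphere_sum (Suc k) = (\<Sum>x\<in>level_set (Suc k). \<Sum>y\<in>nbrs Y x. f y)"
    unfolding sphere_sum_def sum_distrib_left
  proof (intro sum.cong refl)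
    fix x assume "x \<in> level_set (Suc k)"
    hence "x \<in> verts Y" "x \<noteq> a" using graph_dist_self[OF connected a] by (auto simp: level_set_def)
    thus "m * f x = (\<Sum>y\<in>nbrs Y x. f y)" using eqn by simp
  qed
  thus ?thesis by (simp add: sum_level_set_nbrs sphere_sum_def)
qed

lemma sphere_eqn_1: "m * sphere_sum 1 = n * f a + sphere_sum 2"
  using sphere_eqn_Suc[of 0] by (simp add: level_set_0 card_children_centre numeral_2_eq_2)

lemma sphere_eqn_ge_2:
  "m * sphere_sum (Suc (Suc k)) = (real n - 1) * sphere_sum (Suc k) + sphere_sum (Suc (Suc (Suc k)))"
proof -
  have "(\<Sum>z\<in>level_set (Suc k). card (children z) * f z) = (\<Sum>z\<in>level_set (Suc k). (real n - 1) * f z)"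
    using n_ge_3 by (intro sum.cong refl) (simp add: card_children of_nat_diff)
  thus ?thesis using sphere_eqn_Suc[of "Suc k"] by (simp add: sphere_sum_def sum_distrib_left)
qed

lemma growth_pos: "0 < sqrt (real n - 1)"
  using n_ge_3 by simp

lemma growth_squared: "sqrt (real n - 1) * sqrt (real n - 1) = real n - 1"
  using n_ge_3 by simp

lemma scaled_sum_rec:
  "m / sqrt (real n - 1) * scaled_sum (Suc k) = scaled_sum k + scaled_sum (Suc (Suc k))"
proof -
  let ?t = "sqrt (real n - 1)"
  have "m / ?t * scaled_sum (Suc k) = m * sphere_sum (Suc (Suc k)) / (?t * ?t * ?t ^ k)"
    by (simp add: scaled_sum_def)
  also have "\<dots> = (?t * ?t * sphere_sum (Suc k) + sphere_sum (Suc (Suc (Suc k)))) / (?t * ?t * ?t ^ k)"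
    unfolding sphere_eqn_ge_2 growth_squared ..
  also have "\<dots> = scaled_sum k + scaled_sum (Suc (Suc k))"
    using growth_pos by (simp add: scaled_sum_def add_divide_distrib)
  finally show ?thesis .
qed

lemma scaled_sum_nonneg: "0 \<le> scaled_sum k"
  using growth_pos sphere_sum_nonneg by (simp add: scaled_sum_def)

text \<open>The scaled sums form a nonnegative solution of the recurrence with c = m / sqrt (n-1).
  Its first term is positive: if the first sphere sum vanished, its equation would give
  \<open>f a = 0\<close>, and the equation at the centre would read 0 = 1.\<close>

lemma green_spectral_bound: "2 * sqrt (real n - 1) \<le> m"
proof -
  have "sphere_sum 1 \<noteq> 0"
  proof
    assume 0: "sphere_sum 1 = 0"
    hence "real n * f a + sphere_sum 2 = 0" using sphere_eqn_1 by simp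
    hence "real n * f a = 0" using sphere_sum_nonneg[of 2] f_nonneg[OF a]
      by (simp add: add_nonneg_eq_0_iff)
    hence "f a = 0" using n_ge_3 by simp
    thus False using sphere_eqn_0 0 by simp
  qed
  hence "0 < scaled_sum 0" using sphere_sum_nonneg[of 1] by (simp add: scaled_sum_def)
  hence "2 \<le> m / sqrt (real n - 1)"
    by (intro concave_nonneg_recurrence[of scaled_sum] scaled_sum_nonneg scaled_sum_rec)
  thus ?thesis using growth_pos by (simp add: field_simps)
qed

text \<open>\<open>C\<close> serves only to make the scaled sums bounded, hence initially
  nonincreasing; it does not enter the estimate. With t = sqrt (n-1), this and m \<ge> 2 t turn the
  equations at the centre and on the first sphere into 2 t f(a) \<le> s + 1 and t s \<le> n f(a),
  where s is the first sphere sum. Eliminating s leaves (n-2) f(a) \<le> t.\<close>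

lemma green_diagonal_bound:
  assumes C: "\<And>F. finite F \<Longrightarrow> (\<Sum>x\<in>F. (f x)\<^sup>2) \<le> C"
  shows "f a \<le> sqrt (real n - 1) / (real n - 2)"
proof -
  let ?t = "sqrt (real n - 1)"
  have "scaled_sum k \<le> sqrt (n * C)" for k
  proof (rule real_le_rsqrt)
    \<comment> \<open>Cauchy-Schwarz on the sphere: its size \<open>n * (n - 1) ^ k\<close> matches
      the square of the scaling factor, up to \<open>n\<close>.\<close>
    have "(sphere_sum (Suc k))\<^sup>2 \<le> (\<Sum>x\<in>level_set (Suc k). (f x)\<^sup>2) * card (level_set (Suc k))"
      unfolding sphere_sum_def by (rule sum_squared_le_sum_of_squares)
    also have "\<dots> \<le> C * (n * (real n - 1) ^ k)"
      unfolding card_level_set using C[OF finite_level_set] n_ge_3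
      by (intro mult_mono) (auto simp: of_nat_diff C intro: order_trans[OF _ C[of "{}"]])
    finally show "(scaled_sum k)\<^sup>2 \<le> n * C"
      using n_ge_3
      by (simp add: scaled_sum_def power_divide field_simps flip: power_mult power_mult_distrib)
        (simp add: mult.commute[of k] power_mult)
  qed
  moreover have "2 \<le> m / ?t" using green_spectral_bound growth_pos by (simp add: field_simps)
  ultimately have "scaled_sum 1 \<le> scaled_sum 0"
    by (intro convex_bounded_recurrence[of scaled_sum "sqrt (n * C)" "m / ?t"]
        scaled_sum_nonneg scaled_sum_rec)
  hence s2: "sphere_sum 2 \<le> ?t * sphere_sum 1"
    using growth_pos by (simp add: scaled_sum_def field_simps numeral_2_eq_2)
  have "2 * ?t * sphere_sum 1 \<le> m * sphere_sum 1"
    by (intro mult_right_mono green_spectral_bound sphere_sum_nonneg)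
  hence s1: "?t * sphere_sum 1 \<le> n * f a" using s2 sphere_eqn_1 by linarith
  have "2 * ?t * f a \<le> sphere_sum 1 + 1"
    using mult_right_mono[OF green_spectral_bound f_nonneg[OF a]] sphere_eqn_0 by simp
  hence "?t * (2 * ?t * f a) \<le> ?t * (sphere_sum 1 + 1)"
    using growth_pos by (intro mult_left_mono) auto
  also have "\<dots> \<le> n * f a + ?t" using s1 by (simp add: algebra_simps)
  finally have "2 * (?t * ?t) * f a \<le> n * f a + ?t" by (simp add: algebra_simps)
  hence "(real n - 2) * f a \<le> ?t" unfolding growth_squared by (simp add: algebra_simps)
  thus ?thesis using n_ge_3 by (simp add: field_simps)
qed

end

section \<open>The geometric kernel: square sums and equation\<close>

lemma geometric_square_sum_bound:
  fixes r :: real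
  assumes r: "0 < r" "(real n - 1) * r\<^sup>2 < 1" and F: "finite F" "F \<subseteq> verts Y"
  shows "(\<Sum>x\<in>F. (r ^ level x)\<^sup>2) \<le> 1 + n * r\<^sup>2 / (1 - (real n - 1) * r\<^sup>2)"
proof -
  let ?s = "(real n - 1) * r\<^sup>2"
  define N where "N = Suc (Max (insert 0 (level ` F)))"
  have "F \<subseteq> (\<Union>k\<in>{..N}. level_set k)"
  proof
    fix x assume "x \<in> F"
    hence "level x \<le> N" unfolding N_def using F by (intro le_SucI Max_ge) auto
    thus "x \<in> (\<Union>k\<in>{..N}. level_set k)" using \<open>x \<in> F\<close> F(2) by (auto simp: level_set_def)
  qed
  hence "(\<Sum>x\<in>F. (r ^ level x)\<^sup>2) \<le> (\<Sum>x\<in>(\<Union>k\<in>{..N}. level_set k). (r ^ level x)\<^sup>2)"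
    by (intro sum_mono2) (auto simp: finite_level_set)
  also have "\<dots> = (\<Sum>k\<le>N. \<Sum>x\<in>level_set k. (r ^ level x)\<^sup>2)"
    by (rule sum.UNION_disjoint) (auto simp: finite_level_set, auto simp: level_set_def)
  also have "\<dots> = (\<Sum>k\<le>N. card (level_set k) * (r\<^sup>2) ^ k)"
    by (intro sum.cong refl) (simp add: level_set_def power_mult[symmetric] mult.commute)
  also have "\<dots> = 1 + (\<Sum>k<N. n * r\<^sup>2 * ?s ^ k)"
    unfolding sum.atMost_shift using n_ge_3
    by (simp add: level_set_0 card_level_set of_nat_diff power_mult_distrib mult.assoc mult.left_commute)
  also have "\<dots> = 1 + n * r\<^sup>2 * (\<Sum>k<N. ?s ^ k)"
    by (simp add: sum_distrib_left)
  also have "(\<Sum>k<N. ?s ^ k) \<le> 1 / (1 - ?s)"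
  proof -
    have "0 \<le> ?s" using n_ge_3 by simp
    thus ?thesis using r(2) by (simp add: sum_gp_strict divide_right_mono)
  qed
  hence "1 + n * r\<^sup>2 * (\<Sum>k<N. ?s ^ k) \<le> 1 + n * r\<^sup>2 * (1 / (1 - ?s))"
    by (intro add_left_mono mult_left_mono) simp_all
  finally show ?thesis by simp
qed

text \<open>Off the pole the neighbours contribute \<open>r ^ (k - 1)\<close> once and
  \<open>r ^ (k + 1)\<close> n - 1 times. At the pole all n contribute \<open>r\<close>, leaving a
  defect free of n; this lets one normalization serve trees of different degree.\<close>

lemma geometric_kernel_eqn:
  fixes r :: real
  assumes r: "r \<noteq> 0" and x: "x \<in> verts Y"
  shows "(1 / r + (real n - 1) * r) * r ^ level x - (\<Sum>y\<in>nbrs Y x. r ^ level y)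
    = (if x = a then 1 / r - r else 0)"
proof (cases "level x")
  case 0
  hence "x = a" using graph_dist_eq_0[OF connected a x] by simp
  moreover have "(\<Sum>y\<in>children a. r ^ level y) = (\<Sum>y\<in>children a. r)"
    by (intro sum.cong refl) (simp add: children_def graph_dist_self[OF connected a])
  ultimately show ?thesis
    by (simp add: nbrs_centre card_children_centre graph_dist_self[OF connected a] algebra_simps)
next
  case (Suc k)
  hence xk: "x \<in> level_set (Suc k)" using x by (simp add: level_set_def)
  then obtain p where p: "p \<in> level_set k" "p \<notin> children x" "nbrs Y x = insert p (children x)"
    by (rule nbrs_parent)
  have "(\<Sum>y\<in>children x. r ^ level y) = (\<Sum>y\<in>children x. r ^ Suc (Suc k))"
    by (intro sum.cong refl) (simp add: children_def Suc)
  also have "\<dots> = (real n - 1) * r ^ Suc (Suc k)"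
    using n_ge_3 by (simp add: card_children[OF xk] of_nat_diff)
  finally have nbrs_sum: "(\<Sum>y\<in>nbrs Y x. r ^ level y) = r ^ k + (real n - 1) * r ^ Suc (Suc k)"
    using p by (simp add: finite_children level_set_def)
  have "x \<noteq> a" using Suc graph_dist_self[OF connected a] by auto
  thus ?thesis unfolding nbrs_sum Suc using r by (simp add: field_simps)
qed

end

end

section \<open>Green functions on graphs\<close>

context bounded_degree_graph
begin

lemma green_nonneg:
  assumes "x \<in> verts G" "onorm (adj G) < l"
  shows "adj_resolvent G l (delta x) \<in> ell2_nonneg"
  using assms by (intro adj.resolvent_nonneg adj_nonneg) simp_all

lemma Re_green_nonneg:
  assumes "x \<in> verts G" "onorm (adj G) < l"
  shows "0 \<le> Re (coord (adj_resolvent G l (delta x)) y)"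
  using green_nonneg[OF assms] by (simp add: ell2_nonneg_def complex_nonneg_Reals_iff)

lemma green_eqn:
  assumes "x \<in> verts G" "onorm (adj G) < l"
  shows "l * Re (coord (adj_resolvent G l (delta x)) y)
    = (\<Sum>z\<in>nbrs G y. Re (coord (adj_resolvent G l (delta x)) z)) + (if y = x then 1 else 0)"
proof -
  let ?u = "adj_resolvent G l (delta x)"
  have "l *\<^sub>R ?u - adj G ?u = delta x"
    using assms by (intro adj.resolvent_solves) simp_all
  hence "Re (coord (l *\<^sub>R ?u - adj G ?u) y) = Re (coord (delta x) y)" by simp
  thus ?thesis by (simp add: coord_simps coord_adj algebra_simps split: if_splits)
qed

lemma resolvent_coord:
  assumes "f \<in> l2 G" "x \<in> verts G" "onorm (adj G) < l"
  shows "coord (adj_resolvent G l f) x = cinner f (adj_resolvent G l (delta x))"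
  using adj.resolvent_selfadjoint[OF assms(3) adj_selfadjoint assms(1), of "delta x"] assms(2)
  by (simp add: cinner_delta_right)

lemma cnj_green:
  assumes "x \<in> verts G" "onorm (adj G) < l"
  shows "cnj (coord (adj_resolvent G l (delta x)) y) = coord (adj_resolvent G l (delta x)) y"
  using green_nonneg[OF assms] by (auto simp: ell2_nonneg_def complex_eq_iff complex_nonneg_Reals_iff)

lemma resolvent_coord_sum:
  assumes f: "f \<in> l2 G" and x: "x \<in> verts G" and l: "onorm (adj G) < l"
  shows "coord (adj_resolvent G l f) x
    = (\<Sum>\<^sub>\<infinity>y. coord (adj_resolvent G l (delta x)) y * coord f y)"
  unfolding resolvent_coord[OF assms] by (simp add: cinner_def cnj_green[OF x l] mult.commute)

lemma green_sym:
  assumes "x \<in> verts G" "y \<in> verts G" "onorm (adj G) < l"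
  shows "coord (adj_resolvent G l (delta x)) y = coord (adj_resolvent G l (delta y)) x"
proof -
  have "coord (adj_resolvent G l (delta x)) y
      = (\<Sum>\<^sub>\<infinity>z. coord (adj_resolvent G l (delta y)) z * coord (delta x) z)"
    using assms by (intro resolvent_coord_sum) simp_all
  also have "\<dots> = (\<Sum>\<^sub>\<infinity>z\<in>{x}. coord (adj_resolvent G l (delta y)) z)"
    by (rule infsum_cong_neutral) (auto simp: coord_simps)
  finally show ?thesis by simp
qed

text \<open>A Harnack inequality: every term of the resolvent equation is nonnegative, so one
  neighbour is bounded by the whole sum.\<close>

lemma green_nbr_le:
  assumes "x \<in> verts G" "onorm (adj G) < l" "z \<in> nbrs G y"
  shows "Re (coord (adj_resolvent G l (delta x)) z) \<le> l * Re (coord (adj_resolvent G l (delta x)) y)"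
proof -
  have "Re (coord (adj_resolvent G l (delta x)) z)
      \<le> (\<Sum>z\<in>nbrs G y. Re (coord (adj_resolvent G l (delta x)) z))"
    by (rule member_le_sum[OF assms(3)]) (auto simp: finite_nbrs Re_green_nonneg[OF assms(1,2)])
  also have "\<dots> \<le> l * Re (coord (adj_resolvent G l (delta x)) y)"
    unfolding green_eqn[OF assms(1,2)] by simp
  finally show ?thesis .
qed

text \<open>Two Harnack steps, with symmetry moving the pole from x to z between them, cost a factor
  l each.\<close>

lemma green_diagonal_nbr:
  assumes l: "onorm (adj G) < l" and e: "z \<in> nbrs G x"
  shows "Re (coord (adj_resolvent G l (delta x)) x) \<le> l\<^sup>2 * Re (coord (adj_resolvent G l (delta z)) z)"
proof -
  have V: "x \<in> verts G" "z \<in> verts G" using nbrs_verts[OF e] by auto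
  have e': "x \<in> nbrs G z" using e nbrs_sym by blast
  have "0 < l" using l onorm_pos_le[OF bounded_linear_adj] by linarith
  have "Re (coord (adj_resolvent G l (delta x)) x) \<le> l * Re (coord (adj_resolvent G l (delta x)) z)"
    by (rule green_nbr_le[OF V(1) l e'])
  also have "coord (adj_resolvent G l (delta x)) z = coord (adj_resolvent G l (delta z)) x"
    by (rule green_sym[OF V l])
  also have "l * Re (coord (adj_resolvent G l (delta z)) x)
      \<le> l * (l * Re (coord (adj_resolvent G l (delta z)) z))"
    using \<open>0 < l\<close> by (intro mult_left_mono green_nbr_le[OF V(2) l e']) simp
  finally show ?thesis by (simp add: power2_eq_square)
qed

text \<open>Recurrence asserts divergence at some vertex, so the bound at \<open>a\<close> must
  reach every vertex. It travels along a walk through \<open>green_diagonal_nbr\<close>.\<close>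

lemma transient_if_green_bounded:
  assumes conn: "connected_graph G" and a: "a \<in> verts G"
    and bound: "\<And>l. onorm (adj G) < l \<Longrightarrow> Re (coord (adj_resolvent G l (delta a)) a) \<le> C"
  shows "transient G"
proof -
  let ?N = "onorm (adj G)"
  \<comment> \<open>Restricting \<open>l\<close> to a unit window above the norm keeps the factors
    \<open>l\<^sup>2\<close> picked up along the walk bounded.\<close>
  define bnd where "bnd x \<longleftrightarrow>
    (\<exists>C. \<forall>l>?N. l < ?N + 1 \<longrightarrow> Re (coord (adj_resolvent G l (delta x)) x) \<le> C)" for x
  have step: "bnd x" if z: "bnd z" and e: "z \<in> nbrs G x" for x z
  proof -
    obtain C where C: "\<And>l. ?N < l \<Longrightarrow> l < ?N + 1 \<Longrightarrow>
        Re (coord (adj_resolvent G l (delta z)) z) \<le> C"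
      using z unfolding bnd_def by blast
    have V: "z \<in> verts G" using nbrs_verts[OF e] by simp
    have "Re (coord (adj_resolvent G l (delta x)) x) \<le> (?N + 1)\<^sup>2 * C"
      if l: "?N < l" "l < ?N + 1" for l
    proof -
      have "0 \<le> ?N" by (rule onorm_pos_le[OF bounded_linear_adj])
      hence "l\<^sup>2 * Re (coord (adj_resolvent G l (delta z)) z) \<le> (?N + 1)\<^sup>2 * C"
        using l by (intro mult_mono power_mono C Re_green_nonneg V) simp_all
      thus ?thesis using green_diagonal_nbr[OF l(1) e] by linarith
    qed
    thus ?thesis unfolding bnd_def by blast
  qed
  have along: "walk G xs \<Longrightarrow> bnd (last xs) \<Longrightarrow> bnd (hd xs)" for xs
  proof (induction xs rule: induct_list012)
    case (3 x y zs)
    hence "walk G (y # zs)" by (auto simp: walk_def)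
    hence "bnd y" using 3 by simp
    moreover have "y \<in> nbrs G x" using "3.prems"(1) by (simp add: walk_def nbrs_def)
    ultimately show ?case using step by simp
  qed (simp_all add: walk_def)
  have "bnd a" unfolding bnd_def using bound by blast
  have "\<not> recurrent G"
  proof
    assume "recurrent G"
    then obtain x where x: "x \<in> verts G"
      and lim: "filterlim (\<lambda>l. Re (cinner (adj_resolvent G l (delta x)) (delta x))) at_top (at_right ?N)"
      unfolding recurrent_def by blast
    obtain xs where "walk G xs" "hd xs = x" "last xs = a"
      using conn x a unfolding connected_graph_def by blast
    hence "bnd x" using along \<open>bnd a\<close> by blast
    then obtain C where C: "\<And>l. ?N < l \<Longrightarrow> l < ?N + 1 \<Longrightarrow>
        Re (coord (adj_resolvent G l (delta x)) x) \<le> C"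
      unfolding bnd_def by blast
    have "eventually (\<lambda>l. C < Re (coord (adj_resolvent G l (delta x)) x)) (at_right ?N)"
      using lim unfolding filterlim_at_top_dense cinner_delta_right by blast
    moreover have "eventually (\<lambda>l. ?N < l \<and> l < ?N + 1) (at_right ?N)"
      using eventually_at_right[of ?N "?N + 1"] by (auto intro!: exI[of _ "?N + 1"])
    ultimately have "eventually (\<lambda>_. False) (at_right ?N)"
      by eventually_elim (use C in fastforce)
    thus False by simp
  qed
  thus ?thesis using conn bounded_selfadjoint by (simp add: transient_def)
qed

end

lemma sum_Re_coord_le_norm: "finite F \<Longrightarrow> (\<Sum>x\<in>F. (Re (coord f x))\<^sup>2) \<le> (norm f)\<^sup>2"
  by (rule order_trans[OF sum_mono sum_coord_le_norm]) (simp_all add: cmod_power2)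

text \<open>The smaller root of \<open>(n - 1) * r\<^sup>2 - l * r + 1 = 0\<close>.\<close>

definition decay_rate :: "nat \<Rightarrow> real \<Rightarrow> real"
  where "decay_rate n l = (l - sqrt (l\<^sup>2 - 4 * (real n - 1))) / (2 * (real n - 1))"

text \<open>The roots are distinct because l > 2 sqrt (n-1), and their product is 1/(n-1); hence the
  smaller one satisfies (n-1) r^2 < 1, which is what square-summability of \<open>r ^ d\<close>
  requires, and r < 1 since n \<ge> 2.\<close>

lemma decay_rate:
  assumes n: "2 \<le> n" and l: "2 * sqrt (real n - 1) < l"
  shows "0 < decay_rate n l" "(real n - 1) * (decay_rate n l)\<^sup>2 < 1"
    "l = 1 / decay_rate n l + (real n - 1) * decay_rate n l"
    "decay_rate n l < 1"
proof -
  define N where "N = real n - 1"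
  define s where "s = sqrt (l\<^sup>2 - 4 * N)"
  define r where "r = decay_rate n l"
  have N: "1 \<le> N" using n by (simp add: N_def)
  have lpos: "0 < l" using l N real_sqrt_ge_zero[of N] unfolding N_def by linarith
  have "(2 * sqrt N)\<^sup>2 < l\<^sup>2" using l N by (intro power_strict_mono) (simp_all add: N_def)
  hence "0 < l\<^sup>2 - 4 * N" using N by (simp add: power_mult_distrib)
  hence s: "0 < s" "s\<^sup>2 = l\<^sup>2 - 4 * N" by (simp_all add: s_def)
  have "s < l" by (rule power2_less_imp_less) (use s N lpos in auto)
  have r_eq: "2 * N * r = l - s" using N by (simp add: r_def decay_rate_def N_def s_def)
  have r: "0 < r" using r_eq \<open>s < l\<close> N by (smt (verit) zero_less_mult_pos)
  have prod: "(l - s) * (l + s) = 4 * N" using s(2) by (simp add: power2_eq_square algebra_simps)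
  have "4 * N * (N * r\<^sup>2) = (2 * N * r) * (2 * N * r)" by (simp add: power2_eq_square)
  also have "\<dots> = (l - s) * (l - s)" by (simp add: r_eq)
  also have "\<dots> < (l - s) * (l + s)" using s \<open>s < l\<close> by (intro mult_strict_left_mono) auto
  finally have "4 * N * (N * r\<^sup>2) < 4 * N * 1" using prod by simp
  hence Nr: "N * r\<^sup>2 < 1" using N by (simp add: mult_less_cancel_left_pos)
  have "4 * N * (l * r) = 4 * N * (1 + N * r\<^sup>2)"
  proof -
    have "4 * N * (l * r) = 2 * l * (2 * N * r)" by simp
    also have "\<dots> = 2 * l * (l - s)" by (simp only: r_eq)
    also have "\<dots> = (l - s) * (l + s) + (l - s) * (l - s)" by (simp add: algebra_simps)
    also have "\<dots> = 4 * N + (2 * N * r) * (2 * N * r)" by (simp only: prod r_eq)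
    finally show ?thesis by (simp add: power2_eq_square algebra_simps)
  qed
  hence "l * r = 1 + N * r\<^sup>2" using N by simp
  hence leq: "l = 1 / r + N * r" using r by (simp add: field_simps power2_eq_square)
  have "r\<^sup>2 \<le> N * r\<^sup>2" using N by (simp add: mult_le_cancel_right1)
  hence "r\<^sup>2 < 1" using Nr by linarith
  hence "r < 1" using r by (simp add: power2_less_1_iff abs_square_less_1)
  thus "0 < decay_rate n l" "(real n - 1) * (decay_rate n l)\<^sup>2 < 1"
    "l = 1 / decay_rate n l + (real n - 1) * decay_rate n l" "decay_rate n l < 1"
    using r Nr leq unfolding r_def N_def by - assumption+
qed

text \<open>The factor r / (1 - r^2) turns the defect 1/r - r of the geometric kernel into
  1.\<close>

lemma decay_rate_normalization:
  assumes "2 \<le> n" "2 * sqrt (real n - 1) < l"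
  shows "decay_rate n l / (1 - (decay_rate n l)\<^sup>2) * (1 / decay_rate n l - decay_rate n l) = 1"
proof -
  have "0 < decay_rate n l" "(decay_rate n l)\<^sup>2 < 1"
    using decay_rate[OF assms] by (simp_all add: abs_square_less_1)
  thus ?thesis by (simp add: field_simps power2_eq_square)
qed

text \<open>The base of the power in W is the decay rate. For the prefactor, the quadratic equation
  gives 1/r - r = l - Q r, and 2 (Q-1) r = l - s expresses this through the square root s.\<close>

lemma W_entry_decay_rate:
  assumes Q: "2 \<le> Q" and l: "2 * sqrt (real Q - 1) < l"
  shows "W_entry Q X (1 / l) x y =
    l * (decay_rate Q l / (1 - (decay_rate Q l)\<^sup>2) * decay_rate Q l ^ graph_dist X x y)"
proof -
  define N where "N = real Q - 1"
  define s where "s = sqrt (l\<^sup>2 - 4 * N)"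
  define r where "r = decay_rate Q l"
  define c where "c = r / (1 - r\<^sup>2)"
  note r = decay_rate[OF Q l, folded r_def N_def]
  have N: "1 \<le> N" using Q by (simp add: N_def)
  have lpos: "0 < l" using l N real_sqrt_ge_zero[of N] unfolding N_def by linarith
  have r_eq: "2 * N * r = l - s" using N by (simp add: r_def decay_rate_def N_def s_def)
  have "1 - 4 * N * (1 / l)\<^sup>2 = (l\<^sup>2 - 4 * N) / l\<^sup>2"
    using lpos by (simp add: field_simps)
  hence sq: "sqrt (1 - 4 * N * (1 / l)\<^sup>2) = s / l"
    using lpos by (simp add: s_def real_sqrt_divide)
  have base: "(1 - s / l) / (2 * N * (1 / l)) = r"
  proof -
    have "1 - s / l = 2 * N * r / l" unfolding r_eq using lpos by (simp add: diff_divide_distrib)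
    thus ?thesis using N lpos by simp
  qed
  have "c * (1 / r - r) = 1"
    unfolding c_def r_def using Q l by (rule decay_rate_normalization)
  moreover have "1 / r - r = l - real Q * r" using r(3) unfolding N_def by (simp add: algebra_simps)
  ultimately have c: "c * (l - real Q * r) = 1" by simp
  have "2 * N * (l - real Q * r) = 2 * N * l - real Q * (2 * N * r)" by (simp add: algebra_simps)
  also have "\<dots> = (real Q - 2 + real Q * (s / l)) * l"
    unfolding r_eq using lpos by (simp add: N_def field_simps)
  finally have den: "2 * N * (l - real Q * r) = (real Q - 2 + real Q * (s / l)) * l" .
  have "l - real Q * r \<noteq> 0" using c by auto
  hence nz: "(real Q - 2 + real Q * (s / l)) * l \<noteq> 0" using den N
    by (metis mult_eq_0_iff not_one_le_zero zero_neq_numeral)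
  have "l * c * (real Q - 2 + real Q * (s / l)) = c * (2 * N * (l - real Q * r))"
    unfolding den by (simp only: mult_ac)
  also have "\<dots> = 2 * N * (c * (l - real Q * r))" by simp
  finally have "l * c * (real Q - 2 + real Q * (s / l)) = 2 * N" unfolding c by simp
  hence pre: "2 * N / (real Q - 2 + real Q * (s / l)) = l * c"
    using nz by (metis mult_zero_left nonzero_mult_div_cancel_right)
  show ?thesis
    unfolding W_entry_def N_def[symmetric] sq base pre by (simp add: c_def r_def)
qed

section \<open>Norm and Green function of a homogeneous tree\<close>

context homogeneous
begin

text \<open>A nonnegative Green function exists for each m above the norm. Choosing m strictly below
  l makes the inequality strict, as \<open>decay_rate\<close> demands.\<close>

lemma spectral_bound:
  assumes l: "onorm (adj Y) < l"
  shows "2 * sqrt (real n - 1) < l"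
proof -
  obtain a where a: "a \<in> verts Y" using connected by (auto simp: connected_graph_def)
  obtain m where m: "onorm (adj Y) < m" "m < l" using dense[OF l] by blast
  have "2 * sqrt (real n - 1) \<le> m"
    by (rule green_spectral_bound[OF a, of "\<lambda>x. Re (coord (adj_resolvent Y m (delta a)) x)"])
      (simp_all add: Re_green_nonneg[OF a m(1)] green_eqn[OF a m(1)])
  thus ?thesis using m(2) by simp
qed

text \<open>The normalized geometric kernel solves the resolvent equation and is square-summable;
  injectivity of the shifted operator leaves no other candidate.\<close>

lemma green_function:
  fixes l :: real
  defines "r \<equiv> decay_rate n l"
  assumes l: "onorm (adj Y) < l" and a: "a \<in> verts Y"
  shows "coord (adj_resolvent Y l (delta a)) x
    = (if x \<in> verts Y then complex_of_real (r / (1 - r\<^sup>2) * r ^ graph_dist Y a x) else 0)"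
proof -
  define c where "c = r / (1 - r\<^sup>2)"
  define k where "k x = (if x \<in> verts Y then r ^ graph_dist Y a x else 0)" for x
  have "2 \<le> n" using n_ge_3 by simp
  note r = decay_rate[OF this spectral_bound[OF l], folded r_def]
  define M where "M = 1 + n * r\<^sup>2 / (1 - (real n - 1) * r\<^sup>2)"
  have M: "0 \<le> M" using r(2) by (simp add: M_def)
  have c: "c * (1 / r - r) = 1"
    unfolding c_def r_def using \<open>2 \<le> n\<close> spectral_bound[OF l] by (rule decay_rate_normalization)
  have sums: "(\<Sum>x\<in>F. (cmod (complex_of_real (c * k x)))\<^sup>2) \<le> (\<bar>c\<bar> * sqrt M)\<^sup>2" if "finite F" for F
  proof -
    have "(\<Sum>x\<in>F. (k x)\<^sup>2) = (\<Sum>x\<in>F \<inter> verts Y. (r ^ graph_dist Y a x)\<^sup>2)"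
      unfolding sum.inter_restrict[OF that] by (intro sum.cong refl) (simp add: k_def)
    also have "\<dots> \<le> M"
      unfolding M_def using that by (intro geometric_square_sum_bound[OF a r(1,2)]) auto
    finally have "c\<^sup>2 * (\<Sum>x\<in>F. (k x)\<^sup>2) \<le> c\<^sup>2 * M" by (rule mult_left_mono) simp
    thus ?thesis using M
      by (simp add: power_mult_distrib sum_distrib_left norm_mult)
  qed
  define u where "u = Abs_ell2 (\<lambda>x. complex_of_real (c * k x))"
  have u: "coord u x = complex_of_real (c * k x)" for x
    unfolding u_def using bounded_finite_sums_ell2(2)[OF _ sums] M by simp
  have "adj_resolvent Y l (delta a) = u"
  proof (rule adj.resolvent_eqI[OF l])
    show "u \<in> l2 Y" by (simp add: ell2_on_def u k_def)
    show "l *\<^sub>R u - adj Y u = delta a"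
    proof (rule ell2_eqI)
      fix x
      show "coord (l *\<^sub>R u - adj Y u) x = coord (delta a) x"
      proof (cases "x \<in> verts Y")
        case True
        have "(\<Sum>y\<in>nbrs Y x. k y) = (\<Sum>y\<in>nbrs Y x. r ^ graph_dist Y a y)"
          by (intro sum.cong refl) (use nbrs_verts in \<open>auto simp: k_def\<close>)
        hence "l * k x - (\<Sum>y\<in>nbrs Y x. k y) = (if x = a then 1 / r - r else 0)"
          using geometric_kernel_eqn[OF a _ True, of r] r(1,3) True by (simp add: k_def)
        hence "c * (l * k x - (\<Sum>y\<in>nbrs Y x. k y)) = (if x = a then 1 else 0)"
          using c by simp
        moreover have "coord (l *\<^sub>R u - adj Y u) x = of_real (c * (l * k x - (\<Sum>y\<in>nbrs Y x. k y)))"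
          by (simp add: coord_simps coord_adj u scaleR_conv_of_real algebra_simps sum_distrib_left)
        ultimately show ?thesis by (simp add: coord_simps)
      next
        case False
        hence "nbrs Y x = {}" using nbrs_verts by blast
        thus ?thesis using False a by (auto simp: coord_simps coord_adj u k_def)
      qed
    qed
  qed
  thus ?thesis by (simp add: u k_def c_def)
qed

end

section \<open>Loops along a subtree\<close>

locale looped_tree =
  fixes q Q :: nat and X T :: "'v graph"
  assumes q_gt_2: "2 < q" and q_le_Q: "q \<le> Q"
    and hom_X: "homogeneous_tree Q X" and hom_T: "homogeneous_tree q T"
    and sub: "subgraph T X"
begin

sublocale X: homogeneous Q X
  by unfold_locales (use hom_X q_gt_2 q_le_Q in auto)

sublocale T: homogeneous q T
  by unfold_locales (use hom_T q_gt_2 in auto)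

definition looped where "looped = add_loops (verts T) X"

lemma T_subset: "verts T \<subseteq> verts X"
  using sub by (simp add: subgraph_def)

lemma verts_looped: "verts looped = verts X"
  by (simp add: looped_def add_loops_def)

lemma nbrs_looped: "nbrs looped x = nbrs X x \<union> (if x \<in> verts T then {x} else {})"
  by (auto simp: looped_def add_loops_def nbrs_def)

lemma not_self_nbr: "x \<notin> nbrs X x"
  using X.tree by (simp add: nbrs_def tree_def)

sublocale H: bounded_degree_graph looped "Suc Q"
proof
  show "wf_graph looped"
    using X.wf T_subset by (auto simp: wf_graph_def looped_def add_loops_def)
  show "mult looped x y \<le> 1" for x y
    using X.mult_le_1[of x y] not_self_nbr[of x]
    by (auto simp: looped_def add_loops_def nbrs_def)
  show "finite (nbrs looped x)" for x by (simp add: nbrs_looped X.finite_nbrs)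
  have "card (nbrs looped x) \<le> Suc (card (nbrs X x))" for x
    by (simp add: nbrs_looped card_insert_le_m1 card_insert_if X.finite_nbrs)
  thus "card (nbrs looped x) \<le> Suc Q" for x
    using X.card_nbrs[of x] by (meson Suc_le_mono order_trans)
qed

lemma adj_looped: "adj looped f = adj X f + restrict_ell2 (verts T) f"
  by (rule ell2_eqI)
    (simp add: coord_simps restrict_ell2.rep_eq X.coord_adj H.coord_adj nbrs_looped
      X.finite_nbrs not_self_nbr add.commute)

lemma onorm_adj_le: "onorm (adj X) \<le> onorm (adj looped)"
  by (rule onorm_adj_mono[OF X.bounded_degree H.bounded_degree_graph_axioms])
    (simp add: nbrs_looped)

lemma connected_looped: "connected_graph looped"
  unfolding connected_graph_def
proof (intro conjI ballI)
  have walk: "walk looped xs" if "walk X xs" for xs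
    using that unfolding walk_def verts_looped
    by (auto elim!: successively_mono simp: looped_def add_loops_def)
  show "wf_graph looped" by (rule H.wf)
  show "verts looped \<noteq> {}" using X.connected by (simp add: verts_looped connected_graph_def)
  fix x y assume "x \<in> verts looped" "y \<in> verts looped"
  thus "\<exists>xs. walk looped xs \<and> hd xs = x \<and> last xs = y"
    using X.connected walk unfolding verts_looped connected_graph_def by meson
qed

section \<open>Resolvents of the tree and of the looped tree\<close>

context
  fixes l assumes l: "onorm (adj looped) < l"
begin

abbreviation (input) P where "P \<equiv> restrict_ell2 (verts T)"
abbreviation (input) R where "R \<equiv> adj_resolvent X l"
abbreviation (input) S where "S \<equiv> resolvent (l2 X) (adj looped) l"

lemma lX: "onorm (adj X) < l"
  using onorm_adj_le l by linarith

lemma l_pos: "0 < l"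
  using l onorm_pos_le[OF H.bounded_linear_adj] by linarith

lemma l2_T_subset: "f \<in> l2 T \<Longrightarrow> f \<in> l2 X"
  using T_subset by (auto simp: ell2_on_def)

lemma P_in: "P f \<in> l2 T" "P f \<in> l2 X"
  by (rule restrict_ell2_in, intro l2_T_subset restrict_ell2_in)

lemma P_add: "P (f + g) = P f + P g" and P_scaleR: "P (r *\<^sub>R f) = r *\<^sub>R P f"
  using bounded_linear_restrict_ell2[of "verts T"]
  by (simp_all add: bounded_linear.linear linear_add linear_scale)

lemma S_in: "f \<in> l2 X \<Longrightarrow> S f \<in> l2 X"
  using H.adj.resolvent_in[OF l] by (simp add: verts_looped)

text \<open>The second resolvent identity S = R + R P S, with both terms under one \<open>R\<close>
  as in the final formula.\<close>

lemma S_eq_R: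
  assumes f: "f \<in> l2 X"
  shows "S f = R (f + P (S f))"
proof (rule X.adj.resolvent_eqI[OF lX S_in[OF f], symmetric])
  have "l *\<^sub>R S f - adj looped (S f) = f"
    using H.adj.resolvent_solves[OF l] f by (simp add: verts_looped)
  thus "l *\<^sub>R S f - adj X (S f) = f + P (S f)"
    by (simp add: adj_looped algebra_simps)
qed

text \<open>The same identity with the roles exchanged, R = S - S P R. Together the two make
  \<open>1 - P R\<close> and \<open>1 + P S\<close> mutually inverse on \<open>l2 T\<close>.\<close>

lemma R_eq_S:
  assumes f: "f \<in> l2 X"
  shows "R f = S (f - P (R f))"
proof (rule H.adj.resolvent_eqI[OF l, unfolded verts_looped, symmetric])
  show "R f \<in> l2 X" using f by (rule X.adj.resolvent_in[OF lX])
  have "l *\<^sub>R R f - adj X (R f) = f"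
    using f by (rule X.adj.resolvent_solves[OF lX])
  thus "l *\<^sub>R R f - adj looped (R f) = f - P (R f)"
    by (simp add: adj_looped algebra_simps)
qed

lemma Q_ge_2: "2 \<le> Q"
  using q_gt_2 q_le_Q by simp

text \<open>Row x of W(1/l) is l times the Green function of \<open>X\<close> with pole x,
  restricted to \<open>T\<close>. Summability is that of a product of two square-summable
  functions.\<close>

lemma coord_R_P:
  assumes x: "x \<in> verts T"
  shows "(\<lambda>y. W_matrix Q X (1 / l) x y * coord g y) summable_on verts T"
    and "coord (l *\<^sub>R R (P g)) x = (\<Sum>\<^sub>\<infinity>y\<in>verts T. W_matrix Q X (1 / l) x y * coord g y)"
proof -
  have xX: "x \<in> verts X" using x T_subset by blast
  have W: "W_matrix Q X (1 / l) x y * coord g y = of_real l * (coord (R (delta x)) y * coord g y)"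
    if "y \<in> verts T" for y
    using that T_subset
    by (auto simp: X.green_function[OF lX xX] W_entry_decay_rate[OF Q_ge_2 X.spectral_bound[OF lX]])
  have "(\<lambda>y. coord (R (delta x)) y * coord g y) summable_on verts T"
    by (rule summable_on_subset_banach[OF abs_summable_summable[OF ell2_mult_abs_summable]]) simp
  hence "(\<lambda>y. of_real l * (coord (R (delta x)) y * coord g y)) summable_on verts T"
    by (rule summable_on_cmult_right)
  thus "(\<lambda>y. W_matrix Q X (1 / l) x y * coord g y) summable_on verts T"
    by (rule summable_on_cong[THEN iffD2, rotated]) (rule W)
  have "coord (R (P g)) x = (\<Sum>\<^sub>\<infinity>y. coord (R (delta x)) y * coord (P g) y)"
    by (rule X.resolvent_coord_sum[OF P_in(2) xX lX])
  also have "\<dots> = (\<Sum>\<^sub>\<infinity>y\<in>verts T. coord (R (delta x)) y * coord g y)"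
    by (rule infsum_cong_neutral) (auto simp: restrict_ell2.rep_eq)
  finally have "coord (l *\<^sub>R R (P g)) x
      = (\<Sum>\<^sub>\<infinity>y\<in>verts T. of_real l * (coord (R (delta x)) y * coord g y))"
    by (simp add: coord_simps scaleR_conv_of_real infsum_cmult_right')
  also have "\<dots> = (\<Sum>\<^sub>\<infinity>y\<in>verts T. W_matrix Q X (1 / l) x y * coord g y)"
    by (rule infsum_cong) (rule W[symmetric])
  finally show "coord (l *\<^sub>R R (P g)) x = (\<Sum>\<^sub>\<infinity>y\<in>verts T. W_matrix Q X (1 / l) x y * coord g y)" .
qed

lemma matrix_apply_W:
  "matrix_apply (verts T) (W_matrix Q X (1 / l)) g = coord (l *\<^sub>R P (R (P g)))"
proof
  fix x
  show "matrix_apply (verts T) (W_matrix Q X (1 / l)) g x = coord (l *\<^sub>R P (R (P g))) x"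
    using coord_R_P(2)[of x g]
    by (simp add: matrix_apply_def P_scaleR[symmetric] restrict_ell2.rep_eq)
qed

lemma matrix_op_W: "matrix_op (verts T) (W_matrix Q X (1 / l)) g = l *\<^sub>R P (R (P g))"
  unfolding matrix_op_def matrix_apply_W by (rule coord_inverse)

lemma W_op_eq: "(1 / l) *\<^sub>R W_op Q X T (1 / l) g = P (R (P g))"
  using l_pos by (simp add: W_op_def matrix_op_W)

lemma bounded_linear_R_P: "bounded_linear (\<lambda>g. R (P g))"
proof (rule bounded_linear_intro)
  show "R (P (f + g)) = R (P f) + R (P g)" for f g
    unfolding P_add by (rule X.adj.resolvent_add[OF lX P_in(2) P_in(2)])
  show "R (P (r *\<^sub>R f)) = r *\<^sub>R R (P f)" for r f
    unfolding P_scaleR by (rule X.adj.resolvent_scaleR[OF lX P_in(2)])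
  show "norm (R (P f)) \<le> norm f * (1 / (l - onorm (adj X)))" for f
  proof -
    have "norm (R (P f)) \<le> 1 / (l - onorm (adj X)) * norm (P f)"
      by (rule X.adj.norm_resolvent_le[OF lX P_in(2)])
    also have "\<dots> \<le> 1 / (l - onorm (adj X)) * norm f"
      using lX by (intro mult_left_mono norm_restrict_ell2_le) simp
    finally show ?thesis by (simp add: mult.commute)
  qed
qed

lemma bounded_matrix_W: "bounded_matrix (verts T) (W_matrix Q X (1 / l))"
  unfolding bounded_matrix_def
proof (intro conjI allI ballI)
  show "(\<lambda>y. W_matrix Q X (1 / l) x y * coord f y) summable_on verts T" if "x \<in> verts T" for f x
    using that by (rule coord_R_P(1))
  show "(\<lambda>x. (cmod (matrix_apply (verts T) (W_matrix Q X (1 / l)) f x))\<^sup>2) summable_on UNIV" for f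
    unfolding matrix_apply_W by (rule coord_summable)
  have "matrix_op (verts T) (W_matrix Q X (1 / l)) = (\<lambda>g. l *\<^sub>R P (R (P g)))"
    by (rule ext) (rule matrix_op_W)
  moreover have "bounded_linear (\<lambda>g. l *\<^sub>R P (R (P g)))"
    by (intro bounded_linear_intros bounded_linear_compose[OF bounded_linear_scaleR_right]
        bounded_linear_compose[OF bounded_linear_restrict_ell2] bounded_linear_R_P)
  ultimately show "bounded_linear (matrix_op (verts T) (W_matrix Q X (1 / l)))" by simp
qed

lemma W_shift: "g \<in> l2 T \<Longrightarrow> g - (1 / l) *\<^sub>R W_op Q X T (1 / l) g = g - P (R g)"
  by (simp only: W_op_eq restrict_ell2_idem)

lemma W_shift_in: "g \<in> l2 T \<Longrightarrow> g - P (R g) \<in> l2 T"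
  by (intro ell2_on_closed P_in)

lemma W_shift_inverse:
  assumes g: "g \<in> l2 T"
  shows "(g - P (R g)) + P (S (g - P (R g))) = g"
  unfolding R_eq_S[OF l2_T_subset[OF g], symmetric] by simp

lemma W_shift_inverse':
  assumes g: "g \<in> l2 T"
  shows "(g + P (S g)) - P (R (g + P (S g))) = g"
  unfolding S_eq_R[OF l2_T_subset[OF g], symmetric] by simp

text \<open>The inverse is explicit, 1 + P S P; it exists exactly because l lies in the range where
  \<open>S\<close> is defined, so the norm of P R P need not be estimated.\<close>

lemma W_shift_bij:
  "bij_betw (\<lambda>g. g - (1 / l) *\<^sub>R W_op Q X T (1 / l) g) (l2 T) (l2 T)"
proof (rule bij_betw_byWitness[where f' = "\<lambda>g. g + P (S g)"])
  show "\<forall>g\<in>l2 T. (g - (1 / l) *\<^sub>R W_op Q X T (1 / l) g) +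
      P (S (g - (1 / l) *\<^sub>R W_op Q X T (1 / l) g)) = g"
  proof
    fix g assume g: "g \<in> l2 T"
    show "(g - (1 / l) *\<^sub>R W_op Q X T (1 / l) g) +
        P (S (g - (1 / l) *\<^sub>R W_op Q X T (1 / l) g)) = g"
      unfolding W_shift[OF g] by (rule W_shift_inverse[OF g])
  qed
  show "\<forall>g\<in>l2 T. (g + P (S g)) - (1 / l) *\<^sub>R W_op Q X T (1 / l) (g + P (S g)) = g"
  proof
    fix g assume g: "g \<in> l2 T"
    have "g + P (S g) \<in> l2 T" using g by (intro ell2_on_closed P_in)
    thus "(g + P (S g)) - (1 / l) *\<^sub>R W_op Q X T (1 / l) (g + P (S g)) = g"
      using W_shift_inverse'[OF g] by (simp only: W_shift)
  qed
  show "(\<lambda>g. g - (1 / l) *\<^sub>R W_op Q X T (1 / l) g) ` l2 T \<subseteq> l2 T"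
  proof (rule image_subsetI)
    fix g assume "g \<in> l2 T"
    thus "g - (1 / l) *\<^sub>R W_op Q X T (1 / l) g \<in> l2 T" by (simp only: W_shift W_shift_in)
  qed
  show "(\<lambda>g. g + P (S g)) ` l2 T \<subseteq> l2 T"
    by (rule image_subsetI) (intro ell2_on_closed P_in)
qed

text \<open>The constant bounds the norm of the inverse 1 + P S P.\<close>

lemma W_shift_invertible:
  "invertible_on (l2 T) (\<lambda>g. g - (1 / l) *\<^sub>R W_op Q X T (1 / l) g)"
  unfolding invertible_on_def
proof (intro conjI exI ballI)
  fix g assume g: "g \<in> l2 T"
  let ?k = "g - P (R g)"
  have "norm g = norm (?k + P (S ?k))" using W_shift_inverse[OF g] by simp
  also have "\<dots> \<le> norm ?k + norm (S ?k)"
    by (rule order_trans[OF norm_triangle_ineq add_left_mono[OF norm_restrict_ell2_le]])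
  also have "norm (S ?k) \<le> 1 / (l - onorm (adj looped)) * norm ?k"
    using H.adj.norm_resolvent_le[OF l] l2_T_subset[OF W_shift_in[OF g]] by (simp add: verts_looped)
  finally show "norm g \<le> (1 + 1 / (l - onorm (adj looped))) *
      norm (g - (1 / l) *\<^sub>R W_op Q X T (1 / l) g)"
    unfolding W_shift[OF g] by (simp add: distrib_right)
qed (rule W_shift_bij)

text \<open>Applying P to S f = R f + R P S f gives P R f = (1 - P R) P S f, so the inverse sends P
  R f to P S f, and \<open>S_eq_R\<close> is already the formula.\<close>

lemma resolvent_formula:
  assumes f: "f \<in> l2 X"
  shows "S f = R (f + P (inv_into (l2 T) (\<lambda>g. g - (1 / l) *\<^sub>R W_op Q X T (1 / l) g) (P (R f))))"
proof -
  have "P (R f) = P (S f) - P (R (P (S f)))"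
  proof -
    have "S f = R f + R (P (S f))"
      using S_eq_R[OF f] X.adj.resolvent_add[OF lX f P_in(2)] by simp
    hence "P (R f) + P (R (P (S f))) = P (S f)" by (metis P_add)
    thus ?thesis by (simp only: eq_diff_eq)
  qed
  also have "\<dots> = P (S f) - (1 / l) *\<^sub>R W_op Q X T (1 / l) (P (S f))"
    by (rule W_shift[OF P_in(1), symmetric])
  finally have "inv_into (l2 T) (\<lambda>g. g - (1 / l) *\<^sub>R W_op Q X T (1 / l) g) (P (R f)) = P (S f)"
    using bij_betw_inv_into_left[OF W_shift_bij P_in(1)] by simp
  thus ?thesis using S_eq_R[OF f] by (simp only: restrict_ell2_idem[OF P_in(1)])
qed

text \<open>Both trees carry a geometric kernel with the same decay rate, so the compression of the
  resolvent of \<open>X\<close> to \<open>T\<close> inverts a shift of the adjacency operator of \<open>T\<close>.\<close>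

lemma compressed_green_eqn:
  fixes r :: real
  defines "r \<equiv> decay_rate Q l"
  assumes g: "g \<in> l2 T" and x: "x \<in> verts T"
  shows "of_real (1 / r + (real q - 1) * r) * coord (R g) x - (\<Sum>y\<in>nbrs T x. coord (R g) y)
    = coord g x"
proof -
  define v where "v = 1 / r + (real q - 1) * r"
  define c where "c = r / (1 - r\<^sup>2)"
  \<comment> \<open>A combination of Green functions of \<open>X\<close> that restricts to
    \<open>delta x\<close> on \<open>T\<close>. Its values off \<open>T\<close> are harmless, since
    it is paired with \<open>g\<close>, which vanishes there.\<close>
  define w where "w = v *\<^sub>R R (delta x) - (\<Sum>y\<in>nbrs T x. R (delta y))"
  have r: "0 < r"
    unfolding r_def by (rule decay_rate(1)[OF Q_ge_2 X.spectral_bound[OF lX]])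
  have c: "c * (1 / r - r) = 1"
    unfolding c_def r_def by (rule decay_rate_normalization[OF Q_ge_2 X.spectral_bound[OF lX]])
  have green: "coord (R (delta y)) z = of_real (c * r ^ graph_dist T z y)"
    if "y \<in> verts T" "z \<in> verts T" for y z
  proof -
    have V: "y \<in> verts X" "z \<in> verts X" using that T_subset by auto
    have "graph_dist X y z = graph_dist T z y"
      using subtree_graph_dist[OF X.tree T.tree sub that(2,1)] graph_dist_sym[OF X.connected V] by simp
    thus ?thesis using X.green_function[OF lX V(1), of z] V(2) by (simp add: c_def r_def)
  qed
  have w: "coord w z = coord (delta x) z" if z: "z \<in> verts T" for z
  proof -
    have "coord w z = of_real (v * (c * r ^ graph_dist T z x) - (\<Sum>y\<in>nbrs T x. c * r ^ graph_dist T z y))"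
      using green[OF x z] green[OF _ z] T.nbrs_verts
      by (simp add: w_def coord_simps coord_sum T.finite_nbrs scaleR_conv_of_real)
    also have "v * (c * r ^ graph_dist T z x) - (\<Sum>y\<in>nbrs T x. c * r ^ graph_dist T z y)
        = c * (v * r ^ graph_dist T z x - (\<Sum>y\<in>nbrs T x. r ^ graph_dist T z y))"
      by (simp add: algebra_simps sum_distrib_left)
    also have "\<dots> = c * (if x = z then 1 / r - r else 0)"
      unfolding v_def using T.geometric_kernel_eqn[OF z _ x, of r] r by simp
    also have "\<dots> = (if x = z then 1 else 0)" using c by simp
    finally show ?thesis by (simp add: coord_simps)
  qed
  have "coord g x = cinner g (delta x)" by (rule cinner_delta_right[symmetric])
  also have "\<dots> = cinner g w"
    unfolding cinner_def
  proof (rule infsum_cong)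
    fix z
    show "coord g z * cnj (coord (delta x) z) = coord g z * cnj (coord w z)"
      using w[of z] g by (cases "z \<in> verts T") (auto simp: ell2_on_def)
  qed
  also have "\<dots> = of_real v * cinner g (R (delta x)) - (\<Sum>y\<in>nbrs T x. cinner g (R (delta y)))"
    by (simp add: w_def cinner_diff_right cinner_scaleR_right cinner_sum_right T.finite_nbrs)
  also have "cinner g (R (delta y)) = coord (R g) y" if "y \<in> verts T" for y
    using X.resolvent_coord[OF l2_T_subset[OF g] _ lX, of y] that T_subset by auto
  hence "of_real v * cinner g (R (delta x)) - (\<Sum>y\<in>nbrs T x. cinner g (R (delta y)))
      = of_real v * coord (R g) x - (\<Sum>y\<in>nbrs T x. coord (R g) y)"
    using x T.nbrs_verts by simp
  finally show ?thesis by (simp add: v_def)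
qed

text \<open>The source \<open>delta a + P u\<close> lives on \<open>T\<close>, so the compressed
  equation turns the problem on \<open>X\<close> into one on \<open>T\<close>, for which the
  diagonal bound is free of l.\<close>

lemma looped_green_bound:
  assumes a: "a \<in> verts T"
  shows "Re (coord (S (delta a)) a) \<le> sqrt (real q - 1) / (real q - 2)"
proof -
  define r where "r = decay_rate Q l"
  define u where "u = S (delta a)"
  have aX: "a \<in> verts X" using a T_subset by blast
  have aH: "a \<in> verts looped" using aX by (simp add: verts_looped)
  have u: "u = R (delta a + P u)"
    unfolding u_def using aX by (intro S_eq_R) simp
  have g: "delta a + P u \<in> l2 T"
    using a by (intro ell2_on_closed P_in) simp
  \<comment> \<open>The loop term \<open>P u\<close> contributes \<open>u\<close> on the right;
    moving it to the left produces the \<open>- 1\<close>.\<close>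
  have eqn: "(1 / r + (real q - 1) * r - 1) * Re (coord u x)
      = (\<Sum>y\<in>nbrs T x. Re (coord u y)) + (if x = a then 1 else 0)" if x: "x \<in> verts T" for x
  proof -
    have "of_real (1 / r + (real q - 1) * r) * coord u x - (\<Sum>y\<in>nbrs T x. coord u y)
        = coord (delta a + P u) x"
      using compressed_green_eqn[OF g x] u by (simp add: r_def)
    hence "Re (of_real (1 / r + (real q - 1) * r) * coord u x - (\<Sum>y\<in>nbrs T x. coord u y))
        = Re (coord (delta a + P u) x)" by (rule arg_cong)
    hence "(1 / r + (real q - 1) * r) * Re (coord u x) - (\<Sum>y\<in>nbrs T x. Re (coord u y))
        = (if x = a then 1 else 0) + Re (coord u x)"
      using x by (simp add: coord_simps restrict_ell2.rep_eq split: if_splits)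
    thus ?thesis by (simp add: algebra_simps)
  qed
  have "Re (coord u a) \<le> sqrt (real q - 1) / (real q - 2)"
  proof (rule T.green_diagonal_bound[OF a, of "\<lambda>x. Re (coord u x)"])
    show "0 \<le> Re (coord u x)" for x
      using H.Re_green_nonneg[OF aH l, of x] by (simp add: u_def verts_looped)
  qed (rule eqn sum_Re_coord_le_norm; assumption)+
  thus ?thesis by (simp add: u_def)
qed

end

lemma transient_looped: "transient looped"
proof -
  obtain a where a: "a \<in> verts T" using T.connected by (auto simp: connected_graph_def)
  show ?thesis
    by (rule H.transient_if_green_bounded[OF connected_looped, of a])
      (use a T_subset looped_green_bound in \<open>auto simp: verts_looped\<close>)
qed

end

theorem theorem6p5:
  fixes q Q :: nat and X T :: "'v graph"
  assumes "q > 2" and "q \<le> Q" and "int Q \<le> Q_max q"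
    and "homogeneous_tree Q X"
    and "homogeneous_tree q T" and "subgraph T X"
  shows "bounded_matrix (verts X) (adj_matrix X) \<and>
    bounded_matrix (verts X) (adj_matrix (add_loops (verts T) X)) \<and>
    (\<forall>l > onorm (adj (add_loops (verts T) X)).
      invertible_on (l2 X) (\<lambda>f. l *\<^sub>R f - adj X f) \<and>
      invertible_on (l2 X) (\<lambda>f. l *\<^sub>R f - adj (add_loops (verts T) X) f) \<and>
      bounded_matrix (verts T) (W_matrix Q X (1 / l)) \<and>
      invertible_on (l2 T) (\<lambda>g. g - (1 / l) *\<^sub>R W_op Q X T (1 / l) g) \<and>
      (\<forall>f \<in> l2 X.
        adj_resolvent (add_loops (verts T) X) l f =
        adj_resolvent X l (f + orth_proj (l2 T)
          (inv_into (l2 T) (\<lambda>g. g - (1 / l) *\<^sub>R W_op Q X T (1 / l) g)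
            (orth_proj (l2 T) (adj_resolvent X l f)))))) \<and>
    transient (add_loops (verts T) X)"
proof -
  interpret looped_tree q Q X T
    by unfold_locales (use assms in auto)
  show ?thesis
    unfolding orth_proj_ell2_on looped_def[symmetric] verts_looped
  proof (intro conjI allI impI ballI)
    show "bounded_matrix (verts X) (adj_matrix X)" by (rule X.bounded_matrix_adj)
    show "bounded_matrix (verts X) (adj_matrix looped)"
      using H.bounded_matrix_adj by (simp only: verts_looped)
    show "transient looped" by (rule transient_looped)
    fix l assume l: "onorm (adj looped) < l"
    show "invertible_on (l2 X) (\<lambda>f. l *\<^sub>R f - adj X f)"
      by (rule X.adj.shift_invertible[OF lX[OF l]])
    show "invertible_on (l2 X) (\<lambda>f. l *\<^sub>R f - adj looped f)"
      using H.adj.shift_invertible[OF l] by (simp only: verts_looped)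
    show "bounded_matrix (verts T) (W_matrix Q X (1 / l))"
      by (rule bounded_matrix_W[OF l])
    show "invertible_on (l2 T) (\<lambda>g. g - (1 / l) *\<^sub>R W_op Q X T (1 / l) g)"
      by (rule W_shift_invertible[OF l])
    show "resolvent (l2 X) (adj looped) l f = adj_resolvent X l (f + restrict_ell2 (verts T)
        (inv_into (l2 T) (\<lambda>g. g - (1 / l) *\<^sub>R W_op Q X T (1 / l) g)
          (restrict_ell2 (verts T) (adj_resolvent X l f))))" if "f \<in> l2 X" for f
      using that by (rule resolvent_formula[OF l])
  qed
qed

end
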